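(* Let $R$ and $C$ be disjoint finite or countable sets, let $I\subseteq R\times C$, and let $G$ be the bipartite graph with vertex classes $C$ and $R$ whose edges are the pairs $\{r,c\}$ with $(r,c)\in I$. Let $p\in(0,\infty]\setminus\{2,4,6,\dots\}$. If the sequence of elementary matrices $(\mathrm e_{rc})_{(r,c)\in I}$ is a real $1$-unconditional basic sequence in $S^p$, then $G$ contains no cycle. In this case, $I$ is even a set of $V$-interpolation with constant $1$: for every $\varphi\in\ell^\infty_I$ there is a tensor $u\in\ell^\infty_C\widehat\otimes\,\ell^\infty_R$ whose coefficient at $(r,c)$ equals $\varphi_{rc}$ for all $(r,c)\in I$ and such that $\|u\|_{\ell^\infty_C\widehat\otimes\,\ell^\infty_R}=\sup_{q\in I}|\varphi_q|$.
   Context: $\mathrm e_{rc}$ is the elementary matrix, i.e. the operator from $\ell^2_C$ to $\ell^2_R$ mapping the basis vector $\mathrm e_c$ to $\mathrm e_r$ and all other basis vectors to $0$. For $0<p<\infty$, $S^p$ is the Schatten-von-Neumann class of compact operators $x\colon\ell^2_C\to\ell^2_R$ with $\|x\|_p^p=\operatorname{tr}(x^*x)^{p/2}<\infty$; $S^\infty$ is the space of compact operators with the operator norm. The sequence $(\mathrm e_{q})_{q\in I}$ is a real $1$-unconditional basic sequence in $S^p$ if $\|\sum_{q\in I}\epsilon_qa_q\mathrm e_q\|_p=\|\sum_{q\in I}a_q\mathrm e_q\|_p$ for every choice of signs $\epsilon_q\in\{-1,1\}$ and every finitely supported family of complex coefficients $(a_q)_{q\in I}$. A cycle is a closed walk of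 length at least $4$ with pairwise distinct vertices. $X\widehat\otimes\, Y$ denotes the projective tensor product of Banach spaces (completion of $X\otimes Y$ for the projective tensor norm). The coefficient at $(r,c)$ of a tensor $u\in\ell^\infty_C\widehat\otimes\,\ell^\infty_R$ is $\langle \mathrm e_c\otimes\mathrm e_r,u\rangle$ (for an elementary tensor $\zeta\otimes\eta$ it is $\zeta_c\eta_r$). *)

theory Defs
  imports "HOL-Analysis.Analysis"
begin

definition bipartite_edges :: "('v \<times> 'v) set \<Rightarrow> 'v set set" where
  "bipartite_edges I = {{r, c} | r c. (r, c) \<in> I}"

text \<open>A closed walk with pairwise distinct vertices is given by the list of its vertices, the
  first vertex not being repeated at the end: its length is the length of the list.\<close>

definition is_cycle :: "'v set set \<Rightarrow> 'v list \<Rightarrow> bool" where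
  "is_cycle E vs \<longleftrightarrow> 4 \<le> length vs \<and> distinct vs \<and>
     (\<forall>i<length vs. {vs ! i, vs ! ((i + 1) mod length vs)} \<in> E)"

text \<open>Sequence spaces over a set \<open>A\<close> are modelled by functions vanishing outside \<open>A\<close>.
  The inner product is linear in its second argument.\<close>

definition ell2 :: "'v set \<Rightarrow> ('v \<Rightarrow> complex) set" where
  "ell2 A = {\<xi>. (\<forall>v. v \<notin> A \<longrightarrow> \<xi> v = 0) \<and> (\<lambda>v. (cmod (\<xi> v))\<^sup>2) summable_on A}"

definition ell2_inner :: "('v \<Rightarrow> complex) \<Rightarrow> ('v \<Rightarrow> complex) \<Rightarrow> complex" where
  "ell2_inner \<xi> \<eta> = (\<Sum>\<^sub>\<infinity>v. cnj (\<xi> v) * \<eta> v)"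

definition ell2_norm :: "('v \<Rightarrow> complex) \<Rightarrow> real" where
  "ell2_norm \<xi> = sqrt (\<Sum>\<^sub>\<infinity>v. (cmod (\<xi> v))\<^sup>2)"

definition basis_vec :: "'v \<Rightarrow> 'v \<Rightarrow> complex" where
  "basis_vec a = (\<lambda>v. if v = a then 1 else 0)"

type_synonym 'v op = "('v \<Rightarrow> complex) \<Rightarrow> ('v \<Rightarrow> complex)"

definition elementary_matrix :: "'v \<Rightarrow> 'v \<Rightarrow> 'v op" where
  "elementary_matrix r c \<xi> = (\<lambda>v. \<xi> c * basis_vec r v)"

text \<open>The adjoint of a bounded operator \<open>x\<close> from \<open>\<ell>\<^sup>2(C)\<close> to some \<open>\<ell>\<^sup>2\<close>-space, given by its
  coordinates \<open>\<langle>e\<^sub>c, x* \<eta>\<rangle> = \<langle>x e\<^sub>c, \<eta>\<rangle>\<close>.\<close>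

definition adjoint_op :: "'v set \<Rightarrow> 'v op \<Rightarrow> 'v op" where
  "adjoint_op C x \<eta> = (\<lambda>c. if c \<in> C then ell2_inner (x (basis_vec c)) \<eta> else 0)"

definition eigenspace :: "'v set \<Rightarrow> 'v op \<Rightarrow> real \<Rightarrow> ('v \<Rightarrow> complex) set" where
  "eigenspace C T \<mu> = {\<xi> \<in> ell2 C. T \<xi> = (\<lambda>v. of_real \<mu> * \<xi> v)}"

definition orth_proj :: "('v \<Rightarrow> complex) set \<Rightarrow> 'v op" where
  "orth_proj M \<xi> = (THE \<eta>. \<eta> \<in> M \<and> (\<forall>\<zeta>\<in>M. ell2_inner \<zeta> (\<lambda>v. \<xi> v - \<eta> v) = 0))"

text \<open>Functional calculus for a compact positive operator \<open>T\<close> on \<open>\<ell>\<^sup>2(C)\<close> and \<open>s > 0\<close>: by the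
  spectral theorem, \<open>T\<^sup>s\<close> is the sum of \<open>\<mu>\<^sup>s P\<^sub>\<mu>\<close> over the eigenvalues \<open>\<mu> > 0\<close>, where \<open>P\<^sub>\<mu>\<close> is the
  orthogonal projection onto the eigenspace. If \<open>\<mu>\<close> is not an eigenvalue, then \<open>P\<^sub>\<mu> = 0\<close>.\<close>

definition pos_op_power :: "'v set \<Rightarrow> 'v op \<Rightarrow> real \<Rightarrow> 'v op" where
  "pos_op_power C T s \<xi> =
     (\<lambda>v. \<Sum>\<^sub>\<infinity>\<mu>\<in>{0<..}. of_real (\<mu> powr s) * orth_proj (eigenspace C T \<mu>) \<xi> v)"

definition op_trace :: "'v set \<Rightarrow> 'v op \<Rightarrow> complex" where
  "op_trace C T = (\<Sum>\<^sub>\<infinity>c\<in>C. ell2_inner (basis_vec c) (T (basis_vec c)))"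

definition op_norm :: "'v set \<Rightarrow> 'v op \<Rightarrow> real" where
  "op_norm C x = (SUP \<xi>\<in>{\<xi> \<in> ell2 C. ell2_norm \<xi> \<le> 1}. ell2_norm (x \<xi>))"

text \<open>The norm of the Schatten class \<open>S\<^sup>p\<close> of operators from \<open>\<ell>\<^sup>2(C)\<close>, for \<open>0 < p \<le> \<infinity>\<close>. The value is
  meaningful for operators in \<open>S\<^sup>p\<close>, in particular for all operators of finite rank; outside
  \<open>S\<^sup>p\<close> the conventions for divergent sums apply.\<close>

definition schatten_norm :: "ereal \<Rightarrow> 'v set \<Rightarrow> 'v op \<Rightarrow> real" where
  "schatten_norm p C x =
     (if p = \<infinity> then op_norm C x
      else Re (op_trace C (pos_op_power C (adjoint_op C x \<circ> x) (real_of_ereal p / 2)))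
             powr (1 / real_of_ereal p))"

definition matrix_sum :: "('v \<times> 'v) set \<Rightarrow> ('v \<times> 'v \<Rightarrow> complex) \<Rightarrow> 'v op" where
  "matrix_sum I a \<xi> =
     (\<lambda>v. \<Sum>(r, c)\<in>{q \<in> I. a q \<noteq> 0}. a (r, c) * elementary_matrix r c \<xi> v)"

definition real_1_unconditional :: "ereal \<Rightarrow> 'v set \<Rightarrow> ('v \<times> 'v) set \<Rightarrow> bool" where
  "real_1_unconditional p C I \<longleftrightarrow>
     (\<forall>(\<epsilon> :: 'v \<times> 'v \<Rightarrow> real) (a :: 'v \<times> 'v \<Rightarrow> complex).
        (\<forall>q\<in>I. \<epsilon> q \<in> {-1, 1}) \<longrightarrow> finite {q \<in> I. a q \<noteq> 0} \<longrightarrow>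
        schatten_norm p C (matrix_sum I (\<lambda>q. of_real (\<epsilon> q) * a q)) =
        schatten_norm p C (matrix_sum I a))"

definition linf :: "'a set \<Rightarrow> ('a \<Rightarrow> complex) set" where
  "linf A = {\<zeta>. (\<forall>v. v \<notin> A \<longrightarrow> \<zeta> v = 0) \<and> bounded (\<zeta> ` A)}"

text \<open>Inserting \<open>0\<close> only matters for empty \<open>A\<close>.\<close>

definition linf_norm :: "'a set \<Rightarrow> ('a \<Rightarrow> complex) \<Rightarrow> real" where
  "linf_norm A \<zeta> = Sup (insert 0 ((\<lambda>v. cmod (\<zeta> v)) ` A))"

definition bilinear_form_on ::
    "('a \<Rightarrow> complex) set \<Rightarrow> ('b \<Rightarrow> complex) set \<Rightarrow>
     (('a \<Rightarrow> complex) \<Rightarrow> ('b \<Rightarrow> complex) \<Rightarrow> complex) \<Rightarrow> bool" where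
  "bilinear_form_on X Y B \<longleftrightarrow>
     (\<forall>x\<in>X. \<forall>x'\<in>X. \<forall>y\<in>Y. \<forall>z. B (\<lambda>v. z * x v + x' v) y = z * B x y + B x' y) \<and>
     (\<forall>x\<in>X. \<forall>y\<in>Y. \<forall>y'\<in>Y. \<forall>z. B x (\<lambda>v. z * y v + y' v) = z * B x y + B x y')"

text \<open>The list \<open>[(x\<^sub>1, y\<^sub>1), \<dots>, (x\<^sub>n, y\<^sub>n)]\<close> stands for the tensor
  \<open>x\<^sub>1 \<otimes> y\<^sub>1 + \<dots> + x\<^sub>n \<otimes> y\<^sub>n\<close>. Two lists represent the same element of the algebraic tensor product
  iff no bilinear form separates them.\<close>

type_synonym ('a, 'b) tensor_rep = "(('a \<Rightarrow> complex) \<times> ('b \<Rightarrow> complex)) list"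

definition tensor_eq ::
    "('a \<Rightarrow> complex) set \<Rightarrow> ('b \<Rightarrow> complex) set \<Rightarrow>
     ('a, 'b) tensor_rep \<Rightarrow> ('a, 'b) tensor_rep \<Rightarrow> bool" where
  "tensor_eq X Y s t \<longleftrightarrow>
     (\<forall>B. bilinear_form_on X Y B \<longrightarrow>
        (\<Sum>(x, y)\<leftarrow>s. B x y) = (\<Sum>(x, y)\<leftarrow>t. B x y))"

definition tensor_diff ::
    "('a, 'b) tensor_rep \<Rightarrow> ('a, 'b) tensor_rep \<Rightarrow> ('a, 'b) tensor_rep" where
  "tensor_diff s t = s @ map (\<lambda>(x, y). (\<lambda>v. - x v, y)) t"

definition proj_norm :: "'a set \<Rightarrow> 'b set \<Rightarrow> ('a, 'b) tensor_rep \<Rightarrow> real" where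
  "proj_norm A B t =
     Inf {(\<Sum>(x, y)\<leftarrow>s. linf_norm A x * linf_norm B y) | s.
            set s \<subseteq> linf A \<times> linf B \<and> tensor_eq (linf A) (linf B) s t}"

text \<open>The completion, as the set of Cauchy sequences of tensors modulo null sequences.\<close>

definition tensor_Cauchy :: "'a set \<Rightarrow> 'b set \<Rightarrow> (nat \<Rightarrow> ('a, 'b) tensor_rep) set" where
  "tensor_Cauchy A B =
     {U. (\<forall>n. set (U n) \<subseteq> linf A \<times> linf B) \<and>
         (\<forall>e>0. \<exists>N. \<forall>m\<ge>N. \<forall>n\<ge>N. proj_norm A B (tensor_diff (U m) (U n)) < e)}"

definition tensor_null_rel ::
    "'a set \<Rightarrow> 'b set \<Rightarrow>
     ((nat \<Rightarrow> ('a, 'b) tensor_rep) \<times> (nat \<Rightarrow> ('a, 'b) tensor_rep)) set" where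
  "tensor_null_rel A B =
     {(U, V). U \<in> tensor_Cauchy A B \<and> V \<in> tensor_Cauchy A B \<and>
              (\<lambda>n. proj_norm A B (tensor_diff (U n) (V n))) \<longlonglongrightarrow> 0}"

definition linf_proj_tensor :: "'a set \<Rightarrow> 'b set \<Rightarrow> (nat \<Rightarrow> ('a, 'b) tensor_rep) set set" where
  "linf_proj_tensor A B = tensor_Cauchy A B // tensor_null_rel A B"

text \<open>The norm and the coefficient functionals \<open>\<langle>e\<^sub>a \<otimes> e\<^sub>b, \<cdot>\<rangle>\<close> are extended to the completion by
  continuity: the limits do not depend on the representing Cauchy sequence.\<close>

definition proj_tensor_norm ::
    "'a set \<Rightarrow> 'b set \<Rightarrow> (nat \<Rightarrow> ('a, 'b) tensor_rep) set \<Rightarrow> real" where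
  "proj_tensor_norm A B u = (THE l. \<forall>U\<in>u. (\<lambda>n. proj_norm A B (U n)) \<longlonglongrightarrow> l)"

definition tensor_coeff :: "'a \<Rightarrow> 'b \<Rightarrow> (nat \<Rightarrow> ('a, 'b) tensor_rep) set \<Rightarrow> complex" where
  "tensor_coeff a b u = (THE z. \<forall>U\<in>u. (\<lambda>n. \<Sum>(x, y)\<leftarrow>U n. x a * y b) \<longlonglongrightarrow> z)"

end

theory Submission
  imports Defs
begin

text \<open>A cycle of length \<open>2 s\<close> in the graph yields the matrices \<open>1 + \<rho> U\<close>, where \<open>U\<close> is the cyclic shift of
  order \<open>s\<close>, up to one change of sign: \<open>U\<^sup>s = \<epsilon>\<close> with \<open>\<epsilon> = \<plusminus>1\<close>. Their singular values are \<open>\<bar>1 + \<rho> \<omega>\<bar>\<close>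
  with \<open>\<omega>\<^sup>s = \<epsilon>\<close>. Expanding \<open>\<bar>1 + \<rho> \<omega>\<bar>\<^sup>p = (1 + \<rho> \<omega>)\<^bsup>p/2\<^esup> (1 + \<rho> cnj \<omega>)\<^bsup>p/2\<^esup>\<close> in powers of \<open>\<rho>\<close> and
  summing over \<open>\<omega>\<close>, the sign \<open>\<epsilon>\<close> first shows up in the coefficient of \<open>\<rho>\<^sup>s\<close>, through the summand
  \<open>2 \<epsilon> s (p/2 gchoose s)\<close>, which vanishes only if \<open>p/2\<close> is an integer in \<open>{0..<s}\<close>. If \<open>p = \<infinity>\<close>, the
  norm is \<open>1 + \<rho>\<close> exactly for \<open>\<epsilon> = 1\<close>.

  Conversely, in a forest every unimodular \<open>\<phi>\<close> has the form \<open>\<phi>\<^sub>r\<^sub>c = \<zeta>\<^sub>c \<eta>\<^sub>r\<close> with unimodular \<open>\<zeta>\<close>, \<open>\<eta>\<close>,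
  because the product of \<open>\<phi>\<close> and its inverses along a closed walk is \<open>1\<close>. A general \<open>\<phi>\<close> is
  \<open>sup \<bar>\<phi>\<bar>\<close> times the mean of two unimodular functions, so a tensor of rank \<open>2\<close> interpolates it.\<close>

section \<open>Tensors in the completed projective tensor product\<close>

lemma linf_norm_nonneg: "0 \<le> linf_norm A \<zeta>" if "\<zeta> \<in> linf A"
proof -
  have "bdd_above (insert 0 ((\<lambda>v. cmod (\<zeta> v)) ` A))"
    using that by (auto simp: linf_def bounded_iff bdd_above_def image_iff)
      (metis dual_order.trans norm_ge_zero order_refl max.cobounded1 max.cobounded2)
  then show ?thesis unfolding linf_norm_def by (intro cSup_upper) auto
qed

lemma norm_le_linf_norm:
  assumes "\<zeta> \<in> linf A" "a \<in> A"
  shows "cmod (\<zeta> a) \<le> linf_norm A \<zeta>"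
proof -
  obtain b where b: "\<And>v. v \<in> A \<Longrightarrow> cmod (\<zeta> v) \<le> b"
    using assms by (auto simp: linf_def bounded_iff)
  have "bdd_above (insert 0 ((\<lambda>v. cmod (\<zeta> v)) ` A))"
    by (rule bdd_aboveI[of _ "max 0 b"]) (use b in \<open>auto simp: le_max_iff_disj\<close>)
  then show ?thesis unfolding linf_norm_def by (intro cSup_upper) (use assms in auto)
qed

lemma linf_norm_le: "linf_norm A \<zeta> \<le> M" if "0 \<le> M" "\<And>a. a \<in> A \<Longrightarrow> cmod (\<zeta> a) \<le> M"
  unfolding linf_norm_def by (rule cSup_least) (use that in auto)

lemma zero_in_linf: "(\<lambda>v. 0) \<in> linf A"
  by (auto simp: linf_def bounded_iff)

lemma uminus_in_linf: "(\<lambda>v. - \<zeta> v) \<in> linf A" if "\<zeta> \<in> linf A"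
  using that by (auto simp: linf_def bounded_iff)

lemma linf_norm_uminus: "linf_norm A (\<lambda>v. - \<zeta> v) = linf_norm A \<zeta>"
  by (simp add: linf_norm_def)

section \<open>Bilinear forms and costs on representing lists\<close>

lemma bilinear_form_on_uminus:
  assumes "bilinear_form_on (linf A) (linf B) F" "x \<in> linf A" "y \<in> linf B"
  shows "F (\<lambda>v. - x v) y = - F x y"
proof -
  have lin: "\<And>x x' z. x \<in> linf A \<Longrightarrow> x' \<in> linf A \<Longrightarrow> F (\<lambda>v. z * x v + x' v) y = z * F x y + F x' y"
    using assms unfolding bilinear_form_on_def by blast
  \<comment> \<open>With \<open>z = 1\<close> and both vectors zero, linearity says that this value
    is twice itself.\<close>
  have "F (\<lambda>v. 0) y = 0" using lin[OF zero_in_linf zero_in_linf, of 1] by simp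
  then show ?thesis using lin[OF assms(2) zero_in_linf, of "-1"] by simp
qed

abbreviation tensor_neg :: "('a, 'b) tensor_rep \<Rightarrow> ('a, 'b) tensor_rep" where
  "tensor_neg t \<equiv> map (\<lambda>(x, y). (\<lambda>v. - x v, y)) t"

abbreviation tensor_eval ::
    "(('a \<Rightarrow> complex) \<Rightarrow> ('b \<Rightarrow> complex) \<Rightarrow> complex) \<Rightarrow> ('a, 'b) tensor_rep \<Rightarrow> complex" where
  "tensor_eval F t \<equiv> (\<Sum>(x, y)\<leftarrow>t. F x y)"

abbreviation tensor_cost :: "'a set \<Rightarrow> 'b set \<Rightarrow> ('a, 'b) tensor_rep \<Rightarrow> real" where
  "tensor_cost A B t \<equiv> (\<Sum>(x, y)\<leftarrow>t. linf_norm A x * linf_norm B y)"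

lemma tensor_eval_neg:
  assumes "bilinear_form_on (linf A) (linf B) F" "set t \<subseteq> linf A \<times> linf B"
  shows "tensor_eval F (tensor_neg t) = - tensor_eval F t"
  using assms(2) by (induction t) (auto simp: bilinear_form_on_uminus[OF assms(1)])

lemma tensor_eval_diff:
  assumes "bilinear_form_on (linf A) (linf B) F" "set t \<subseteq> linf A \<times> linf B"
  shows "tensor_eval F (tensor_diff s t) = tensor_eval F s - tensor_eval F t"
  using tensor_eval_neg[OF assms] by (simp add: tensor_diff_def)

lemma set_tensor_neg: "set (tensor_neg t) \<subseteq> linf A \<times> linf B" if "set t \<subseteq> linf A \<times> linf B"
  using that uminus_in_linf by fastforce

lemma set_tensor_diff:
  "set (tensor_diff s t) \<subseteq> linf A \<times> linf B"
  if "set s \<subseteq> linf A \<times> linf B" "set t \<subseteq> linf A \<times> linf B"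
  using that set_tensor_neg[of t A B] by (auto simp: tensor_diff_def)

lemma tensor_cost_nonneg: "0 \<le> tensor_cost A B t" if "set t \<subseteq> linf A \<times> linf B"
  using that by (intro sum_list_nonneg) (auto intro!: mult_nonneg_nonneg linf_norm_nonneg)

lemma tensor_cost_neg: "tensor_cost A B (tensor_neg t) = tensor_cost A B t"
  by (induction t) (auto simp: linf_norm_uminus)

section \<open>The projective seminorm on representing lists\<close>

lemma proj_norm_le_cost:
  assumes "set s \<subseteq> linf A \<times> linf B" "tensor_eq (linf A) (linf B) s t"
  shows "proj_norm A B t \<le> tensor_cost A B s"
  unfolding proj_norm_def
  by (rule cInf_lower) (use assms tensor_cost_nonneg in \<open>auto intro!: bdd_belowI[of _ 0]\<close>)

text \<open>A lower estimate of the infimum needs some representation to exist; \<open>t\<close>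
  represents itself.\<close>

lemma proj_norm_ge:
  assumes "set t \<subseteq> linf A \<times> linf B"
    "\<And>s. set s \<subseteq> linf A \<times> linf B \<Longrightarrow> tensor_eq (linf A) (linf B) s t \<Longrightarrow> l \<le> tensor_cost A B s"
  shows "l \<le> proj_norm A B t"
  unfolding proj_norm_def
proof (rule cInf_greatest)
  have "tensor_eq (linf A) (linf B) t t" by (simp add: tensor_eq_def)
  then show "{tensor_cost A B s |s. set s \<subseteq> linf A \<times> linf B \<and> tensor_eq (linf A) (linf B) s t} \<noteq> {}"
    using assms(1) by blast
qed (use assms(2) in blast)

lemma proj_norm_nonneg: "0 \<le> proj_norm A B t" if "set t \<subseteq> linf A \<times> linf B"
  using that by (rule proj_norm_ge) (rule tensor_cost_nonneg)

lemma proj_norm_cong: "proj_norm A B s = proj_norm A B t" if "tensor_eq (linf A) (linf B) s t"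
proof -
  have "tensor_eq (linf A) (linf B) w s \<longleftrightarrow> tensor_eq (linf A) (linf B) w t" for w
    using that by (auto simp: tensor_eq_def)
  then show ?thesis by (simp add: proj_norm_def)
qed

lemma proj_norm_append:
  assumes s: "set s \<subseteq> linf A \<times> linf B" and t: "set t \<subseteq> linf A \<times> linf B"
  shows "proj_norm A B (s @ t) \<le> proj_norm A B s + proj_norm A B t"
proof -
  \<comment> \<open>Concatenation adds both tensors and costs. The two infima are taken in turn:
    first over \<open>t'\<close> with \<open>s'\<close> fixed, then over \<open>s'\<close>.\<close>
  have "proj_norm A B (s @ t) - tensor_cost A B s' \<le> proj_norm A B t"
    if s': "set s' \<subseteq> linf A \<times> linf B" "tensor_eq (linf A) (linf B) s' s" for s'
  proof (rule proj_norm_ge[OF t])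
    fix t' assume t': "set t' \<subseteq> linf A \<times> linf B" "tensor_eq (linf A) (linf B) t' t"
    have "proj_norm A B (s @ t) \<le> tensor_cost A B (s' @ t')"
      by (rule proj_norm_le_cost) (use s' t' in \<open>auto simp: tensor_eq_def\<close>)
    then show "proj_norm A B (s @ t) - tensor_cost A B s' \<le> tensor_cost A B t'" by simp
  qed
  then have "proj_norm A B (s @ t) - proj_norm A B t \<le> proj_norm A B s"
    by (intro proj_norm_ge[OF s]) (simp add: algebra_simps)
  then show ?thesis by simp
qed

text \<open>Negating the first factors of a representation of \<open>t\<close> leaves its cost
  unchanged and yields a representation of the negated tensor.\<close>

lemma proj_norm_neg:
  assumes "set t \<subseteq> linf A \<times> linf B"
  shows "proj_norm A B (tensor_neg t) \<le> proj_norm A B t"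
proof (rule proj_norm_ge[OF assms])
  fix s assume s: "set s \<subseteq> linf A \<times> linf B" "tensor_eq (linf A) (linf B) s t"
  have "tensor_eq (linf A) (linf B) (tensor_neg s) (tensor_neg t)"
    using s(2) unfolding tensor_eq_def by (metis tensor_eval_neg s(1) assms)
  then have "proj_norm A B (tensor_neg t) \<le> tensor_cost A B (tensor_neg s)"
    by (intro proj_norm_le_cost set_tensor_neg s)
  then show "proj_norm A B (tensor_neg t) \<le> tensor_cost A B s" by (simp only: tensor_cost_neg)
qed

lemma proj_norm_diff_commute_le:
  assumes "set s \<subseteq> linf A \<times> linf B" "set t \<subseteq> linf A \<times> linf B"
  shows "proj_norm A B (tensor_diff s t) \<le> proj_norm A B (tensor_diff t s)"
proof -
  have "tensor_eq (linf A) (linf B) (tensor_diff s t) (tensor_neg (tensor_diff t s))"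
    unfolding tensor_eq_def
    by (auto simp: tensor_eval_diff[OF _ assms(1)] tensor_eval_diff[OF _ assms(2)]
        tensor_eval_neg[OF _ set_tensor_diff[OF assms(2,1)]] simp del: map_map)
  then show ?thesis using proj_norm_neg[OF set_tensor_diff[OF assms(2,1)]] proj_norm_cong by metis
qed

lemma proj_norm_triangle:
  assumes "set s \<subseteq> linf A \<times> linf B" "set t \<subseteq> linf A \<times> linf B"
  shows "proj_norm A B s \<le> proj_norm A B t + proj_norm A B (tensor_diff s t)"
proof -
  have "tensor_eq (linf A) (linf B) s (t @ tensor_diff s t)"
    unfolding tensor_eq_def by (auto simp: tensor_eval_diff[OF _ assms(2)])
  then have "proj_norm A B s = proj_norm A B (t @ tensor_diff s t)" by (rule proj_norm_cong)
  also have "\<dots> \<le> proj_norm A B t + proj_norm A B (tensor_diff s t)"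
    by (intro proj_norm_append set_tensor_diff assms)
  finally show ?thesis .
qed

lemma abs_proj_norm_diff:
  assumes "set s \<subseteq> linf A \<times> linf B" "set t \<subseteq> linf A \<times> linf B"
  shows "\<bar>proj_norm A B s - proj_norm A B t\<bar> \<le> proj_norm A B (tensor_diff t s)"
  using proj_norm_triangle[OF assms] proj_norm_triangle[OF assms(2,1)]
    proj_norm_diff_commute_le[OF assms] by linarith

lemma proj_norm_diff_self:
  assumes "set t \<subseteq> linf A \<times> linf B"
  shows "proj_norm A B (tensor_diff t t) = 0"
proof (rule antisym)
  \<comment> \<open>The empty list is a representation of cost 0.\<close>
  have "tensor_eq (linf A) (linf B) [] (tensor_diff t t)"
    unfolding tensor_eq_def by (auto simp: tensor_eval_diff[OF _ assms])
  then show "proj_norm A B (tensor_diff t t) \<le> 0" using proj_norm_le_cost[of "[]" A B] by simp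
qed (intro proj_norm_nonneg set_tensor_diff assms)

section \<open>Coefficients, and the embedding into the completion\<close>

lemma bilinear_form_on_coeff: "bilinear_form_on X Y (\<lambda>x y. x a * y b)"
  by (auto simp: bilinear_form_on_def algebra_simps)

lemma tensor_coeff_le_cost:
  assumes "a \<in> A" "b \<in> B" "set s \<subseteq> linf A \<times> linf B"
  shows "cmod (tensor_eval (\<lambda>x y. x a * y b) s) \<le> tensor_cost A B s"
  using assms(3)
proof (induction s)
  case (Cons q s)
  obtain x y where q: "q = (x, y)" by (cases q)
  have xy: "x \<in> linf A" "y \<in> linf B" using Cons.prems q by auto
  have "cmod (x a * y b) \<le> linf_norm A x * linf_norm B y"
    unfolding norm_mult
    by (intro mult_mono norm_le_linf_norm linf_norm_nonneg xy assms) auto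
  then show ?case using Cons q by (auto intro: order.trans[OF norm_triangle_ineq] add_mono)
qed simp

text \<open>A coefficient is the value of a bilinear form, so it is shared by all representations,
  and the cost of each of them dominates it. This contractivity carries coefficients over to limits
  and also bounds the norm from below.\<close>

lemma tensor_coeff_le_proj_norm:
  assumes "a \<in> A" "b \<in> B" "set t \<subseteq> linf A \<times> linf B"
  shows "cmod (tensor_eval (\<lambda>x y. x a * y b) t) \<le> proj_norm A B t"
proof (rule proj_norm_ge[OF assms(3)])
  fix s assume s: "set s \<subseteq> linf A \<times> linf B" "tensor_eq (linf A) (linf B) s t"
  have "tensor_eval (\<lambda>x y. x a * y b) s = tensor_eval (\<lambda>x y. x a * y b) t"
    using s(2) bilinear_form_on_coeff[of "linf A" "linf B" a b] unfolding tensor_eq_def by (elim allE impE)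
  then show "cmod (tensor_eval (\<lambda>x y. x a * y b) t) \<le> tensor_cost A B s"
    using tensor_coeff_le_cost[OF assms(1,2) s(1)] by simp
qed

text \<open>The class of the constant sequence is taken. For the two \<open>THE\<close> operators,
  the contraction estimates give the same limit along every sequence in the class, and the constant
  sequence itself forces uniqueness.\<close>

lemma linf_proj_tensor_of_list:
  assumes t: "set t \<subseteq> linf A \<times> linf B"
  obtains u where "u \<in> linf_proj_tensor A B"
    "\<And>a b. a \<in> A \<Longrightarrow> b \<in> B \<Longrightarrow> tensor_coeff a b u = (\<Sum>(x, y)\<leftarrow>t. x a * y b)"
    "proj_tensor_norm A B u = proj_norm A B t"
proof
  define u where "u = tensor_null_rel A B `` {\<lambda>n::nat. t}"
  have cau: "(\<lambda>n. t) \<in> tensor_Cauchy A B"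
    using t by (auto simp: tensor_Cauchy_def proj_norm_diff_self)
  then have self: "(\<lambda>n. t) \<in> u"
    using t by (auto simp: u_def tensor_null_rel_def proj_norm_diff_self)
  show "u \<in> linf_proj_tensor A B"
    unfolding linf_proj_tensor_def u_def by (rule quotientI[OF cau])
  have U: "set (U n) \<subseteq> linf A \<times> linf B"
    "(\<lambda>n. proj_norm A B (tensor_diff t (U n))) \<longlonglongrightarrow> 0" if "U \<in> u" for U n
    using that by (auto simp: u_def tensor_null_rel_def tensor_Cauchy_def)
  show "tensor_coeff a b u = (\<Sum>(x, y)\<leftarrow>t. x a * y b)" if ab: "a \<in> A" "b \<in> B" for a b
    unfolding tensor_coeff_def
  proof (rule the_equality)
    show "\<forall>V\<in>u. (\<lambda>n. \<Sum>(x, y)\<leftarrow>V n. x a * y b) \<longlonglongrightarrow> (\<Sum>(x, y)\<leftarrow>t. x a * y b)"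
    proof
      fix V assume V: "V \<in> u"
      show "(\<lambda>n. \<Sum>(x, y)\<leftarrow>V n. x a * y b) \<longlonglongrightarrow> (\<Sum>(x, y)\<leftarrow>t. x a * y b)"
      proof (rule LIM_zero_cancel)
        show "(\<lambda>n. (\<Sum>(x, y)\<leftarrow>V n. x a * y b) - (\<Sum>(x, y)\<leftarrow>t. x a * y b)) \<longlonglongrightarrow> 0"
        proof (rule Lim_null_comparison[OF _ U(2)[OF V]], rule always_eventually, rule allI)
          fix n
          show "cmod ((\<Sum>(x, y)\<leftarrow>V n. x a * y b) - (\<Sum>(x, y)\<leftarrow>t. x a * y b))
              \<le> proj_norm A B (tensor_diff t (V n))"
            using tensor_coeff_le_proj_norm[OF ab set_tensor_diff[OF t U(1)[OF V]]]
              tensor_eval_diff[OF bilinear_form_on_coeff U(1)[OF V]] by (metis norm_minus_commute)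
        qed
      qed
    qed
    show "z = (\<Sum>(x, y)\<leftarrow>t. x a * y b)" if "\<forall>V\<in>u. (\<lambda>n. \<Sum>(x, y)\<leftarrow>V n. x a * y b) \<longlonglongrightarrow> z" for z
      using bspec[OF that self] LIMSEQ_unique tendsto_const by blast
  qed
  show "proj_tensor_norm A B u = proj_norm A B t"
    unfolding proj_tensor_norm_def
  proof (rule the_equality)
    show "\<forall>V\<in>u. (\<lambda>n. proj_norm A B (V n)) \<longlonglongrightarrow> proj_norm A B t"
    proof
      fix V assume V: "V \<in> u"
      have "(\<lambda>n. proj_norm A B (V n) - proj_norm A B t) \<longlonglongrightarrow> 0"
        by (rule Lim_null_comparison[OF _ U(2)[OF V]], rule always_eventually)
          (use abs_proj_norm_diff[OF U(1)[OF V] t] in simp)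
      then show "(\<lambda>n. proj_norm A B (V n)) \<longlonglongrightarrow> proj_norm A B t" by (rule LIM_zero_cancel)
    qed
    show "l = proj_norm A B t" if "\<forall>V\<in>u. (\<lambda>n. proj_norm A B (V n)) \<longlonglongrightarrow> l" for l
      using bspec[OF that self] LIMSEQ_unique tendsto_const by blast
  qed
qed

section \<open>Gains along walks in a forest\<close>

fun gain :: "('v \<Rightarrow> 'v \<Rightarrow> 'g::comm_monoid_mult) \<Rightarrow> 'v list \<Rightarrow> 'g" where
  "gain w (u # v # vs) = w u v * gain w (v # vs)"
| "gain w vs = 1"

text \<open>The cut vertex \<open>y\<close> is kept in both pieces, so that no edge gets
  lost.\<close>

lemma gain_append: "gain w (xs @ y # ys) = gain w (xs @ [y]) * gain w (y # ys)"
proof (induction xs)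
  case (Cons x xs)
  then show ?case by (cases xs) (auto simp: mult.assoc)
qed simp

abbreviation walk :: "'v set set \<Rightarrow> 'v list \<Rightarrow> bool" where
  "walk E \<equiv> successively (\<lambda>u v. {u, v} \<in> E)"

lemma walk_append: "walk E (xs @ y # ys) \<longleftrightarrow> walk E (xs @ [y]) \<and> walk E (y # ys)"
  by (auto simp: successively_append_iff successively_Cons)

lemma closed_walk_is_cycle:
  assumes "walk E (last ys # ys)" "distinct ys" "4 \<le> length ys"
  shows "is_cycle E ys"
  unfolding is_cycle_def
proof (intro conjI allI impI assms(2,3))
  fix i assume i: "i < length ys"
  have ne: "ys \<noteq> []" using assms(3) by auto
  have w: "{(last ys # ys) ! j, (last ys # ys) ! Suc j} \<in> E" if "Suc j < length (last ys # ys)" for j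
    using assms(1) that by (auto simp: successively_conv_nth)
  show "{ys ! i, ys ! ((i + 1) mod length ys)} \<in> E"
  proof (cases "i + 1 < length ys")
    case True
    then show ?thesis using w[of "Suc i"] by simp
  next
    case False
    then have "i = length ys - 1" using i by simp
    \<comment> \<open>The closing edge of the cycle is the first edge of the walk
      \<open>last ys # ys\<close>.\<close>
    then show ?thesis using w[of 0] ne i by (simp add: last_conv_nth)
  qed
qed

text \<open>Induction on the length. If only the end vertex repeats, acyclicity leaves at most three
  edges: one or three contradict bipartiteness, and two run back and forth along one edge, with gain
  1. Otherwise a repeated vertex splits the walk into two shorter closed walks.\<close>

lemma gain_closed_walk:
  assumes I: "I \<subseteq> R \<times> C" "R \<inter> C = {}"
    and acyclic: "\<nexists>vs. is_cycle (bipartite_edges I) vs"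
    and w: "\<And>u v. {u, v} \<in> bipartite_edges I \<Longrightarrow> w u v * w v u = 1"
    and "walk (bipartite_edges I) vs" "vs \<noteq> []" "hd vs = last vs"
  shows "gain w vs = 1"
  using assms(5-7)
proof (induction "length vs" arbitrary: vs rule: less_induct)
  case less
  have edge: "u \<in> R \<and> v \<in> C \<or> u \<in> C \<and> v \<in> R" if "{u, v} \<in> bipartite_edges I" for u v
    using that I(1) by (auto simp: bipartite_edges_def doubleton_eq_iff)
  obtain v ys where vs: "vs = v # ys" using less.prems by (cases vs) auto
  show ?case
  proof (cases "ys = []")
    case True
    then show ?thesis using vs by simp
  next
    case ne: False
    have last: "last ys = v" using less.prems vs ne by simp
    show ?thesis
    proof (cases "distinct ys")
      case True
      have "\<not> 4 \<le> length ys" using closed_walk_is_cycle[of _ ys] True less.prems vs last acyclic by auto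
      then consider a where "ys = [a]" | a b where "ys = [a, b]" | a b c where "ys = [a, b, c]"
        using ne by (auto simp: neq_Nil_conv not_le)
          (metis One_nat_def Suc_lessI length_0_conv length_Suc_conv less_Suc_eq_0_disj numeral_2_eq_2 numeral_3_eq_3 numeral_Bit0 not_less_eq Suc_less_eq2)
      then show ?thesis
      proof cases
        case 1
        then have "{v, v} \<in> bipartite_edges I" using less.prems vs last by simp
        then show ?thesis using edge[of v v] I(2) by blast
      next
        case 2
        then show ?thesis using less.prems vs last w by auto
      next
        case 3
        then have "{v, a} \<in> bipartite_edges I" "{a, b} \<in> bipartite_edges I" "{b, v} \<in> bipartite_edges I"
          using less.prems vs last by auto
        then show ?thesis using edge[of v a] edge[of a b] edge[of b v] I(2) by blast
      qed
    next
      case False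
      \<comment> \<open>The detour from \<open>y\<close> through \<open>bs\<close> back to
        \<open>y\<close> is closed, and so is the walk that remains when it is cut out.\<close>
      then obtain as bs cs y where ys: "ys = as @ [y] @ bs @ [y] @ cs"
        using not_distinct_decomp by blast
      have vs': "vs = (v # as) @ y # bs @ y # cs" using ys vs by simp
      have wk: "walk (bipartite_edges I) ((v # as) @ [y])" "walk (bipartite_edges I) ((y # bs) @ [y])"
        "walk (bipartite_edges I) (y # cs)"
      proof -
        have "walk (bipartite_edges I) ((v # as) @ y # (bs @ y # cs))" using less.prems(1) vs' by simp
        note 1 = walk_append[THEN iffD1, OF this]
        then have "walk (bipartite_edges I) ((y # bs) @ y # cs)" by simp
        note 2 = walk_append[THEN iffD1, OF this]
        show "walk (bipartite_edges I) ((v # as) @ [y])" "walk (bipartite_edges I) ((y # bs) @ [y])"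
          "walk (bipartite_edges I) (y # cs)"
          using 1 2 by blast+
      qed
      have 1: "gain w ((y # bs) @ [y]) = 1" by (rule less.hyps) (use wk vs' in auto)
      have "gain w ((v # as) @ y # cs) = 1"
      proof (rule less.hyps)
        show "walk (bipartite_edges I) ((v # as) @ y # cs)"
          using walk_append[of _ "v # as" y cs] wk by blast
        show "hd ((v # as) @ y # cs) = last ((v # as) @ y # cs)"
          using last ys by (simp split: if_splits)
      qed (use vs' in auto)
      then have "gain w ((v # as) @ [y]) * gain w (y # cs) = 1"
        using gain_append[of w "v # as" y cs] by simp
      then show ?thesis
        using gain_append[of w "v # as" y "bs @ y # cs"] gain_append[of w "y # bs" y cs] 1
        unfolding vs' by simp
    qed
  qed
qed

section \<open>Potentials and factorization of unimodular functions\<close>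

lemma walk_rev: "walk E (rev vs) \<longleftrightarrow> walk E vs"
  by (simp add: successively_rev insert_commute)

lemma gain_rev:
  fixes w :: "'v \<Rightarrow> 'v \<Rightarrow> complex"
  assumes "\<And>u v. {u, v} \<in> E \<Longrightarrow> w u v * w v u = 1" "walk E vs"
  shows "gain w vs * gain w (rev vs) = 1"
  using assms(2)
proof (induction vs)
  case (Cons x vs)
  show ?case
  proof (cases vs)
    case (Cons y ys)
    have e: "{x, y} \<in> E" "walk E vs" using Cons.prems Cons by auto
    have "gain w (rev (x # vs)) = gain w (rev vs) * w y x"
      using gain_append[of w "rev ys" y "[x]"] Cons by simp
    then show ?thesis using Cons Cons.IH[OF e(2)] assms(1)[OF e(1)]
      by (simp add: algebra_simps)
  qed simp
qed simp

text \<open>The potential of a vertex is the gain of any walk to it from the chosen root of its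
  component.\<close>

lemma ex_potential:
  fixes w :: "'v \<Rightarrow> 'v \<Rightarrow> complex"
  assumes I: "I \<subseteq> R \<times> C" "R \<inter> C = {}"
    and acyclic: "\<nexists>vs. is_cycle (bipartite_edges I) vs"
    and w: "\<And>u v. {u, v} \<in> bipartite_edges I \<Longrightarrow> w u v * w v u = 1"
    and unit: "\<And>u v. {u, v} \<in> bipartite_edges I \<Longrightarrow> cmod (w u v) = 1"
  obtains t where "\<And>v. cmod (t v) = 1" "\<And>u v. {u, v} \<in> bipartite_edges I \<Longrightarrow> t v = w u v * t u"
proof
  let ?E = "bipartite_edges I"
  define joins where "joins u v vs \<longleftrightarrow> vs \<noteq> [] \<and> hd vs = u \<and> last vs = v \<and> walk ?E vs" for u v vs
  define root where "root v = (SOME u. \<exists>vs. joins u v vs)" for v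
  define path where "path v = (SOME vs. joins (root v) v vs)" for v
  define t where "t v = gain w (path v)" for v
  have refl: "joins v v [v]" for v by (simp add: joins_def)
  have path: "joins (root v) v (path v)" for v
    unfolding path_def root_def by (rule someI_ex, rule someI_ex) (use refl in blast)
  have step: "joins u v' (vs @ [v'])" if "joins u v vs" "{v, v'} \<in> ?E" for u v v' vs
    using that by (auto simp: joins_def successively_append_iff)
  have gain_step: "gain w (vs @ [v']) = gain w vs * w v v'" if "joins u v vs" for u v v' vs
  proof -
    have "vs = butlast vs @ [v]" using that append_butlast_last_id[of vs] by (auto simp: joins_def)
    then show ?thesis using gain_append[of w "butlast vs" v "[v']"] by (metis append.assoc append_Cons append_Nil gain.simps(1,3) mult.right_neutral)
  qed
  \<comment> \<open>Following \<open>p\<close> and then \<open>q\<close> backwards gives a closed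
    walk, of gain 1; \<open>butlast\<close> keeps the turning point \<open>v\<close> from occurring
    twice.\<close>
  have unique: "gain w p = gain w q" if p: "joins u v p" and q: "joins u v q" for u v p q
  proof -
    obtain q' where q': "rev q = v # q'" using q
      by (metis joins_def hd_rev list.exhaust_sel rev_is_Nil_conv)
    have p': "p = butlast p @ [v]" using p append_butlast_last_id[of p] by (auto simp: joins_def)
    have wk: "walk ?E (v # q')" "walk ?E (butlast p @ [v])"
      using p q q' p' walk_rev[of ?E q] by (auto simp: joins_def)
    have "last (v # q') = u" using q q' by (metis joins_def last_rev)
    moreover have "hd (butlast p @ v # q') = u"
      using p p' by (metis joins_def hd_append list.sel(1))
    ultimately have "gain w (butlast p @ v # q') = 1"
      using walk_append[of ?E "butlast p" v q'] wk
      by (intro gain_closed_walk[OF I acyclic w]) auto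
    then have "gain w p * gain w (rev q) = 1" using gain_append[of w "butlast p" v q'] p' q' by simp
    moreover have "gain w q * gain w (rev q) = 1"
      using q by (intro gain_rev[OF w]) (auto simp: joins_def)
    ultimately show ?thesis by (metis mult.left_commute mult.right_neutral)
  qed
  have "cmod (gain w vs) = 1" if "walk ?E vs" for vs
    using that by (induction vs rule: induct_list012) (auto simp: norm_mult unit)
  then show "cmod (t v) = 1" for v using path by (auto simp: t_def joins_def)
  have join_sym: "\<exists>vs. joins u v' vs" if "joins u v vs" "{v, v'} \<in> ?E" for u v v' vs
    using step that by blast
  show "t v = w u v * t u" if e: "{u, v} \<in> ?E" for u v
  proof -
    \<comment> \<open>Adjacent vertices are joined to the same vertices, so \<open>SOME\<close> is
      applied to the same predicate and picks the same root.\<close>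
    have "(\<exists>vs. joins x u vs) \<longleftrightarrow> (\<exists>vs. joins x v vs)" for x
      using join_sym e by (metis insert_commute)
    then have root: "root u = root v" by (simp add: root_def)
    have "gain w (path v) = gain w (path u @ [v])"
      by (rule unique[OF path]) (use step[OF path e] root in simp)
    then show ?thesis using gain_step[OF path] by (simp add: t_def mult.commute)
  qed
qed

text \<open>The weights are \<open>\<phi>\<close> from row to column and its inverse backwards; the
  orientation is unambiguous since \<open>R\<close> and \<open>C\<close> are disjoint. A potential
  \<open>t\<close> satisfies \<open>t c = \<phi> (r, c) * t r\<close>, so \<open>t\<close> on
  \<open>C\<close> and \<open>inverse t\<close> on \<open>R\<close> are the factors.\<close>

lemma unimodular_factorization:
  fixes \<phi> :: "'v \<times> 'v \<Rightarrow> complex"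
  assumes I: "I \<subseteq> R \<times> C" "R \<inter> C = {}"
    and acyclic: "\<nexists>vs. is_cycle (bipartite_edges I) vs"
    and unit: "\<And>q. q \<in> I \<Longrightarrow> cmod (\<phi> q) = 1"
  obtains \<zeta> \<eta> where "\<zeta> \<in> linf C" "\<eta> \<in> linf R" "linf_norm C \<zeta> \<le> 1" "linf_norm R \<eta> \<le> 1"
    "\<And>r c. (r, c) \<in> I \<Longrightarrow> \<zeta> c * \<eta> r = \<phi> (r, c)"
proof -
  define w where "w u v = (if (u, v) \<in> I then \<phi> (u, v) else inverse (\<phi> (v, u)))" for u v
  have anti: "(v, u) \<notin> I" if "(u, v) \<in> I" for u v using that I by blast
  have edge: "{u, v} \<in> bipartite_edges I \<longleftrightarrow> (u, v) \<in> I \<or> (v, u) \<in> I" for u v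
    by (auto simp: bipartite_edges_def doubleton_eq_iff)
  have nz: "\<phi> q \<noteq> 0" if "q \<in> I" for q using unit[OF that] by auto
  obtain t where t: "\<And>v. cmod (t v) = 1" "\<And>u v. {u, v} \<in> bipartite_edges I \<Longrightarrow> t v = w u v * t u"
    by (rule ex_potential[OF I acyclic, of w])
      (use anti nz unit in \<open>auto simp: edge w_def norm_inverse\<close>)
  have t0: "t v \<noteq> 0" for v using t(1)[of v] by auto
  show ?thesis
  proof
    show "(\<lambda>v. if v \<in> C then t v else 0) \<in> linf C" "(\<lambda>v. if v \<in> R then inverse (t v) else 0) \<in> linf R"
      using t by (auto simp: linf_def bounded_iff norm_inverse)
    show "linf_norm C (\<lambda>v. if v \<in> C then t v else 0) \<le> 1"
      "linf_norm R (\<lambda>v. if v \<in> R then inverse (t v) else 0) \<le> 1"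
      using t by (auto intro!: linf_norm_le simp: norm_inverse)
    show "(if c \<in> C then t c else 0) * (if r \<in> R then inverse (t r) else 0) = \<phi> (r, c)"
      if rc: "(r, c) \<in> I" for r c
    proof -
      have "r \<in> R" "c \<in> C" using rc I by auto
      moreover have "t c = \<phi> (r, c) * t r" using t(2)[of r c] rc by (simp add: edge w_def)
      ultimately show ?thesis using t0 by simp
    qed
  qed
qed

text \<open>For \<open>M > 0\<close>, a point of the disc of radius \<open>M\<close> is the midpoint
  of a chord: its endpoints lie at the angles \<open>arccos (cmod z / M)\<close> to either side of
  \<open>Arg z\<close>.\<close>

lemma average_of_unimodular:
  assumes "cmod z \<le> M"
  shows "\<exists>a b. cmod a = 1 \<and> cmod b = 1 \<and> z = of_real (M / 2) * a + of_real (M / 2) * b"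
proof (cases "M = 0")
  case True
  then show ?thesis using assms by (intro exI[of _ 1]) auto
next
  case False
  define x where "x = cmod z / M"
  have M: "M > 0" using False assms norm_ge_zero[of z] by linarith
  have x: "-1 \<le> x" "x \<le> 1" using assms M by (auto simp: x_def intro: order.trans[of _ 0])
  have sum: "cis (arccos x) + cis (- arccos x) = 2 * of_real x"
    using x by (auto simp: complex_eq_iff)
  have "z = of_real M * of_real x * cis (Arg z)"
    using M rcis_cmod_Arg[of z] by (simp add: x_def rcis_def)
  also have "\<dots> = of_real (M / 2) * (cis (Arg z) * (cis (arccos x) + cis (- arccos x)))"
    unfolding sum by (simp add: mult.commute mult.left_commute)
  finally have "z = of_real (M / 2) * (cis (Arg z) * (cis (arccos x) + cis (- arccos x)))" .
  then have "z = of_real (M / 2) * cis (Arg z + arccos x) + of_real (M / 2) * cis (Arg z + - arccos x)"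
    unfolding cis_mult[symmetric] by (simp only: distrib_left)
  then show ?thesis by (metis norm_cis)
qed

text \<open>Both unimodular functions averaging to \<open>\<phi> / M\<close> factorize. Each
  product, scaled by \<open>M / 2\<close> in its first factor, costs at most \<open>M / 2\<close>,
  so the sum of the two tensors has norm at most \<open>M\<close>.\<close>

lemma acyclic_interpolation:
  assumes I: "I \<subseteq> R \<times> C" "R \<inter> C = {}"
    and acyclic: "\<nexists>vs. is_cycle (bipartite_edges I) vs"
    and \<phi>: "\<phi> \<in> linf I"
  shows "\<exists>u\<in>linf_proj_tensor C R. (\<forall>(r, c)\<in>I. tensor_coeff c r u = \<phi> (r, c)) \<and>
    proj_tensor_norm C R u = linf_norm I \<phi>"
proof -
  define M where "M = linf_norm I \<phi>"
  have M: "0 \<le> M" using linf_norm_nonneg[OF \<phi>] by (simp add: M_def)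
  have "\<forall>q. \<exists>a b. q \<in> I \<longrightarrow> cmod a = 1 \<and> cmod b = 1 \<and> \<phi> q = of_real (M / 2) * a + of_real (M / 2) * b"
    using average_of_unimodular norm_le_linf_norm[OF \<phi>] unfolding M_def by blast
  then obtain \<alpha> \<beta> where ab: "\<And>q. q \<in> I \<Longrightarrow> cmod (\<alpha> q) = 1" "\<And>q. q \<in> I \<Longrightarrow> cmod (\<beta> q) = 1"
    "\<And>q. q \<in> I \<Longrightarrow> \<phi> q = of_real (M / 2) * \<alpha> q + of_real (M / 2) * \<beta> q"
    by metis
  obtain \<zeta> \<eta> where 1: "\<zeta> \<in> linf C" "\<eta> \<in> linf R" "linf_norm C \<zeta> \<le> 1" "linf_norm R \<eta> \<le> 1"
    "\<And>r c. (r, c) \<in> I \<Longrightarrow> \<zeta> c * \<eta> r = \<alpha> (r, c)"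
    using unimodular_factorization[OF I acyclic, of \<alpha>] ab(1) by blast
  obtain \<zeta>' \<eta>' where 2: "\<zeta>' \<in> linf C" "\<eta>' \<in> linf R" "linf_norm C \<zeta>' \<le> 1" "linf_norm R \<eta>' \<le> 1"
    "\<And>r c. (r, c) \<in> I \<Longrightarrow> \<zeta>' c * \<eta>' r = \<beta> (r, c)"
    using unimodular_factorization[OF I acyclic, of \<beta>] ab(2) by blast
  define sc where "sc \<xi> = (\<lambda>v. of_real (M / 2) * \<xi> v)" for \<xi> :: "'a \<Rightarrow> complex"
  have sc: "sc \<xi> \<in> linf C" "linf_norm C (sc \<xi>) * linf_norm R \<upsilon> \<le> M / 2"
    if \<xi>: "\<xi> \<in> linf C" "linf_norm C \<xi> \<le> 1" and \<upsilon>: "\<upsilon> \<in> linf R" "linf_norm R \<upsilon> \<le> 1" for \<xi> \<upsilon>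
  proof -
    have le: "cmod (sc \<xi> v) \<le> M / 2" if "v \<in> C" for v
      using norm_le_linf_norm[OF \<xi>(1) that] \<xi>(2) M
      by (simp add: sc_def norm_mult mult_left_le)
    then have "bounded (sc \<xi> ` C)" unfolding bounded_iff by blast
    then show "sc \<xi> \<in> linf C" using \<xi>(1) by (auto simp: linf_def sc_def)
    have "linf_norm C (sc \<xi>) \<le> M / 2" by (rule linf_norm_le) (use le M in auto)
    then show "linf_norm C (sc \<xi>) * linf_norm R \<upsilon> \<le> M / 2"
      using mult_mono[of "linf_norm C (sc \<xi>)" "M / 2" "linf_norm R \<upsilon>" 1] \<upsilon> M linf_norm_nonneg
      by auto
  qed
  define t where "t = [(sc \<zeta>, \<eta>), (sc \<zeta>', \<eta>')]"
  have t: "set t \<subseteq> linf C \<times> linf R" using 1 2 sc(1) by (auto simp: t_def)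
  have coeff: "(\<Sum>(x, y)\<leftarrow>t. x c * y r) = \<phi> (r, c)" if "(r, c) \<in> I" for r c
    using ab(3)[OF that] 1(5)[OF that] 2(5)[OF that] by (simp add: t_def sc_def mult.assoc)
  obtain u where u: "u \<in> linf_proj_tensor C R"
    "\<And>a b. a \<in> C \<Longrightarrow> b \<in> R \<Longrightarrow> tensor_coeff a b u = (\<Sum>(x, y)\<leftarrow>t. x a * y b)"
    "proj_tensor_norm C R u = proj_norm C R t"
    using linf_proj_tensor_of_list[OF t] by metis
  have "proj_norm C R t \<le> tensor_cost C R t"
    by (rule proj_norm_le_cost[OF t]) (simp add: tensor_eq_def)
  also have "\<dots> \<le> M" using sc(2)[of \<zeta> \<eta>] sc(2)[of \<zeta>' \<eta>'] 1 2 by (simp add: t_def)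
  finally have "proj_norm C R t \<le> M" .
  \<comment> \<open>Conversely, the norm dominates every coefficient, and the coefficients on
    \<open>I\<close> are those of \<open>\<phi>\<close>.\<close>
  moreover have "M \<le> proj_norm C R t"
    unfolding M_def
  proof (rule linf_norm_le)
    fix q assume q: "q \<in> I"
    then obtain r c where rc: "q = (r, c)" "r \<in> R" "c \<in> C" using I by blast
    show "cmod (\<phi> q) \<le> proj_norm C R t"
      using tensor_coeff_le_proj_norm[OF rc(3,2) t] coeff q rc(1) by simp
  qed (rule proj_norm_nonneg[OF t])
  ultimately show ?thesis using u coeff I(1) by (intro bexI[of _ u]) (auto simp: M_def)
qed

section \<open>Schatten norms of finite matrices\<close>

lemma ell2_inner_finite_left:
  assumes "finite F" "\<And>v. v \<notin> F \<Longrightarrow> \<xi> v = 0"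
  shows "ell2_inner \<xi> \<eta> = (\<Sum>v\<in>F. cnj (\<xi> v) * \<eta> v)"
proof -
  have "ell2_inner \<xi> \<eta> = (\<Sum>\<^sub>\<infinity>v\<in>F. cnj (\<xi> v) * \<eta> v)"
    unfolding ell2_inner_def by (rule infsum_cong_neutral) (use assms in auto)
  then show ?thesis using assms(1) by simp
qed

lemma ell2_norm_finite:
  assumes "finite F" "\<And>v. v \<notin> F \<Longrightarrow> \<xi> v = 0"
  shows "ell2_norm \<xi> = sqrt (\<Sum>v\<in>F. (cmod (\<xi> v))\<^sup>2)"
proof -
  have "(\<Sum>\<^sub>\<infinity>v. (cmod (\<xi> v))\<^sup>2) = (\<Sum>\<^sub>\<infinity>v\<in>F. (cmod (\<xi> v))\<^sup>2)"
    by (rule infsum_cong_neutral) (use assms in auto)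
  then show ?thesis using assms(1) by (simp add: ell2_norm_def)
qed

lemma ell2_finite_support:
  assumes "finite F" "F \<subseteq> A" "\<And>v. v \<notin> F \<Longrightarrow> \<xi> v = 0"
  shows "\<xi> \<in> ell2 A"
proof -
  have "(\<lambda>v. (cmod (\<xi> v))\<^sup>2) summable_on F \<longleftrightarrow> (\<lambda>v. (cmod (\<xi> v))\<^sup>2) summable_on A"
    by (rule summable_on_cong_neutral) (use assms in auto)
  then show ?thesis using assms by (auto simp: ell2_def)
qed

lemma sum_le_ell2_norm:
  assumes "\<xi> \<in> ell2 A" "finite F"
  shows "(\<Sum>v\<in>F. (cmod (\<xi> v))\<^sup>2) \<le> (ell2_norm \<xi>)\<^sup>2"
proof -
  have "(\<lambda>v. (cmod (\<xi> v))\<^sup>2) summable_on A \<longleftrightarrow> (\<lambda>v. (cmod (\<xi> v))\<^sup>2) summable_on UNIV"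
    by (rule summable_on_cong_neutral) (use assms in \<open>auto simp: ell2_def\<close>)
  then have "(\<lambda>v. (cmod (\<xi> v))\<^sup>2) summable_on UNIV" using assms by (auto simp: ell2_def)
  then have "(\<Sum>v\<in>F. (cmod (\<xi> v))\<^sup>2) \<le> (\<Sum>\<^sub>\<infinity>v. (cmod (\<xi> v))\<^sup>2)"
    by (rule finite_sum_le_infsum) (use assms in auto)
  moreover have "0 \<le> (\<Sum>\<^sub>\<infinity>v. (cmod (\<xi> v))\<^sup>2)" by (rule infsum_nonneg) auto
  ultimately show ?thesis by (simp add: ell2_norm_def)
qed

lemma ell2_inner_basis_vec: "ell2_inner (basis_vec c) \<eta> = \<eta> c"
  by (subst ell2_inner_finite_left[of "{c}"]) (auto simp: basis_vec_def)

lemma of_real_cmod_square: "(complex_of_real (cmod z))\<^sup>2 = z * cnj z"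
  by (simp add: complex_norm_square[symmetric])

text \<open>The singular values are the moduli of the complex numbers \<open>\<sigma> k\<close>.\<close>

locale singular_decomposition =
  fixes C F G :: "'v set" and K :: "'k set" and \<sigma> :: "'k \<Rightarrow> complex"
    and f g :: "'k \<Rightarrow> 'v \<Rightarrow> complex" and x :: "'v op"
  assumes finite: "finite F" "finite G" "finite K" and F: "F \<subseteq> C"
    and f_outside: "\<And>k v. v \<notin> F \<Longrightarrow> f k v = 0"
    and g_outside: "\<And>k v. v \<notin> G \<Longrightarrow> g k v = 0"
    and f_orthonormal: "\<And>k l. k \<in> K \<Longrightarrow> l \<in> K \<Longrightarrow> (\<Sum>v\<in>F. cnj (f k v) * f l v) = (if k = l then 1 else 0)"
    and g_orthonormal: "\<And>k l. k \<in> K \<Longrightarrow> l \<in> K \<Longrightarrow> (\<Sum>v\<in>G. cnj (g k v) * g l v) = (if k = l then 1 else 0)"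
    and nonzero: "\<And>k. k \<in> K \<Longrightarrow> \<sigma> k \<noteq> 0"
    and decomp: "\<And>\<xi> v. x \<xi> v = (\<Sum>k\<in>K. \<sigma> k * ell2_inner (f k) \<xi> * g k v)"
begin

lemma inner_f: "ell2_inner (f k) \<xi> = (\<Sum>v\<in>F. cnj (f k v) * \<xi> v)"
  by (rule ell2_inner_finite_left[OF finite(1) f_outside])

text \<open>The subset \<open>L\<close> will be the set of indices that belong to one
  eigenvalue.\<close>

lemma inner_f_combination:
  assumes "k \<in> K" "L \<subseteq> K"
  shows "ell2_inner (f k) (\<lambda>v. \<Sum>l\<in>L. a l * f l v) = (if k \<in> L then a k else 0)"
proof -
  have "ell2_inner (f k) (\<lambda>v. \<Sum>l\<in>L. a l * f l v) = (\<Sum>l\<in>L. a l * (\<Sum>v\<in>F. cnj (f k v) * f l v))"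
    unfolding inner_f sum_distrib_left
    by (subst sum.swap) (simp add: mult.left_commute mult.assoc)
  also have "\<dots> = (\<Sum>l\<in>L. if k = l then a l else 0)"
    by (rule sum.cong) (use assms f_orthonormal in auto)
  finally show ?thesis using finite_subset[OF assms(2) finite(3)] by simp
qed

lemma inner_f_basis_vec: "ell2_inner (f k) (basis_vec c) = cnj (f k c)"
  using finite(1) f_outside[of c k] by (auto simp: inner_f basis_vec_def if_distrib[of "\<lambda>z. _ * z"] cong: if_cong)

text \<open>Parseval's identity, for an abstract family \<open>h\<close> because it serves both
  \<open>f\<close> and \<open>g\<close>.\<close>

lemma inner_combination:
  assumes "finite H" "\<And>k v. v \<notin> H \<Longrightarrow> h k v = 0"
    and orth: "\<And>k l. k \<in> K \<Longrightarrow> l \<in> K \<Longrightarrow> (\<Sum>v\<in>H. cnj (h k v) * h l v) = (if k = l then 1 else 0)"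
  shows "(\<Sum>v\<in>H. cnj (\<Sum>k\<in>K. a k * h k v) * (\<Sum>k\<in>K. b k * h k v)) = (\<Sum>k\<in>K. cnj (a k) * b k)"
proof -
  have "(\<Sum>v\<in>H. cnj (\<Sum>k\<in>K. a k * h k v) * (\<Sum>k\<in>K. b k * h k v))
      = (\<Sum>v\<in>H. \<Sum>k\<in>K. \<Sum>l\<in>K. cnj (a k) * b l * (cnj (h k v) * h l v))"
    unfolding cnj_sum sum_product by (intro sum.cong refl) simp
  also have "\<dots> = (\<Sum>k\<in>K. \<Sum>l\<in>K. cnj (a k) * b l * (\<Sum>v\<in>H. cnj (h k v) * h l v))"
    unfolding sum_distrib_left by (subst sum.swap, rule sum.cong[OF refl], rule sum.swap)
  also have "\<dots> = (\<Sum>k\<in>K. \<Sum>l\<in>K. if k = l then cnj (a k) * b l else 0)"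
    by (intro sum.cong refl) (use orth in auto)
  finally show ?thesis using finite(3) by simp
qed

text \<open>Orthonormality of \<open>g\<close> removes the cross terms, which leaves the spectral
  decomposition along \<open>f\<close>.\<close>

lemma adjoint_comp:
  "(adjoint_op C x \<circ> x) \<xi> = (\<lambda>v. \<Sum>k\<in>K. of_real ((cmod (\<sigma> k))\<^sup>2) * ell2_inner (f k) \<xi> * f k v)"
proof
  fix c
  show "(adjoint_op C x \<circ> x) \<xi> c
    = (\<Sum>k\<in>K. of_real ((cmod (\<sigma> k))\<^sup>2) * ell2_inner (f k) \<xi> * f k c)"
  proof (cases "c \<in> C")
    case True
    have "ell2_inner (x (basis_vec c)) (x \<xi>)
      = (\<Sum>v\<in>G. cnj (\<Sum>k\<in>K. (\<sigma> k * cnj (f k c)) * g k v) * (\<Sum>k\<in>K. (\<sigma> k * ell2_inner (f k) \<xi>) * g k v))"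
      by (subst ell2_inner_finite_left[OF finite(2)]) (simp_all add: decomp g_outside inner_f_basis_vec)
    also have "\<dots> = (\<Sum>k\<in>K. cnj (\<sigma> k * cnj (f k c)) * (\<sigma> k * ell2_inner (f k) \<xi>))"
      by (rule inner_combination[OF finite(2) g_outside g_orthonormal])
    also have "\<dots> = (\<Sum>k\<in>K. of_real ((cmod (\<sigma> k))\<^sup>2) * ell2_inner (f k) \<xi> * f k c)"
      by (intro sum.cong refl) (simp add: of_real_cmod_square algebra_simps)
    finally show ?thesis using True by (simp add: adjoint_op_def)
  next
    case False
    then have "f k c = 0" for k using F f_outside by blast
    then show ?thesis using False by (simp add: adjoint_op_def)
  qed
qed

section \<open>Functional calculus and trace\<close>

abbreviation T :: "'v op" where "T \<equiv> adjoint_op C x \<circ> x"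

text \<open>An eigenvector for \<open>\<mu> > 0\<close> lies in the range of \<open>T\<close>, hence
  in the span of the \<open>f k\<close>; comparing coefficients leaves only the indices with
  eigenvalue \<open>\<mu>\<close>.\<close>

lemma eigenspace_iff:
  assumes "\<mu> > 0"
  shows "\<xi> \<in> eigenspace C T \<mu> \<longleftrightarrow> \<xi> = (\<lambda>v. \<Sum>k\<in>{k \<in> K. (cmod (\<sigma> k))\<^sup>2 = \<mu>}. ell2_inner (f k) \<xi> * f k v)"
    (is "_ \<longleftrightarrow> \<xi> = ?P")
proof
  assume "\<xi> \<in> eigenspace C T \<mu>"
  then have eq: "of_real \<mu> * \<xi> v = (\<Sum>k\<in>K. (of_real ((cmod (\<sigma> k))\<^sup>2) * ell2_inner (f k) \<xi>) * f k v)" for v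
    unfolding eigenspace_def adjoint_comp by (metis (mono_tags, lifting) mem_Collect_eq)
  have coef: "of_real ((cmod (\<sigma> k))\<^sup>2) * ell2_inner (f k) \<xi> = of_real \<mu> * ell2_inner (f k) \<xi>" if "k \<in> K" for k
  proof -
    have "ell2_inner (f k) (\<lambda>v. of_real \<mu> * \<xi> v) = of_real ((cmod (\<sigma> k))\<^sup>2) * ell2_inner (f k) \<xi>"
      unfolding eq by (subst inner_f_combination) (use that in auto)
    then show ?thesis by (simp add: inner_f sum_distrib_left mult.left_commute)
  qed
  have inner: "ell2_inner (f k) \<xi> = 0" if "k \<in> K" "(cmod (\<sigma> k))\<^sup>2 \<noteq> \<mu>" for k
    using coef[OF that(1)] that(2) by (metis mult_right_cancel of_real_eq_iff)
  show "\<xi> = ?P"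
  proof
    fix v
    have "of_real \<mu> * \<xi> v = (\<Sum>k\<in>K. of_real \<mu> * (if (cmod (\<sigma> k))\<^sup>2 = \<mu> then ell2_inner (f k) \<xi> * f k v else 0))"
      unfolding eq by (intro sum.cong refl) (use inner in auto)
    also have "\<dots> = of_real \<mu> * ?P v"
      unfolding sum_distrib_left[symmetric] using finite(3) by (simp add: sum.inter_filter)
    finally show "\<xi> v = ?P v" using assms by simp
  qed
next
  assume P: "\<xi> = ?P"
  have inner: "ell2_inner (f k) \<xi> = 0" if "k \<in> K" "(cmod (\<sigma> k))\<^sup>2 \<noteq> \<mu>" for k
    using inner_f_combination[OF that(1), of "{k \<in> K. (cmod (\<sigma> k))\<^sup>2 = \<mu>}" "\<lambda>k. ell2_inner (f k) \<xi>"] that P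
    by auto
  have "T \<xi> v = of_real \<mu> * \<xi> v" for v
  proof -
    have "T \<xi> v = (\<Sum>k\<in>K. if (cmod (\<sigma> k))\<^sup>2 = \<mu> then of_real \<mu> * (ell2_inner (f k) \<xi> * f k v) else 0)"
      unfolding adjoint_comp by (intro sum.cong refl) (use inner in auto)
    also have "\<dots> = of_real \<mu> * ?P v" unfolding sum_distrib_left using finite(3) by (simp add: sum.inter_filter)
    also have "\<dots> = of_real \<mu> * \<xi> v" using P by metis
    finally show ?thesis .
  qed
  moreover have "\<xi> \<in> ell2 C"
    by (rule ell2_finite_support[OF finite(1) F], subst P) (simp add: f_outside)
  ultimately show "\<xi> \<in> eigenspace C T \<mu>" by (auto simp: eigenspace_def)
qed

lemma orth_proj_eigenspace:
  assumes "\<mu> > 0"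
  shows "orth_proj (eigenspace C T \<mu>) \<xi>
    = (\<lambda>v. \<Sum>k\<in>{k \<in> K. (cmod (\<sigma> k))\<^sup>2 = \<mu>}. ell2_inner (f k) \<xi> * f k v)"
proof -
  define L where "L = {k \<in> K. (cmod (\<sigma> k))\<^sup>2 = \<mu>}"
  have L: "L \<subseteq> K" by (auto simp: L_def)
  define P where "P = (\<lambda>v. \<Sum>k\<in>L. ell2_inner (f k) \<xi> * f k v)"
  have eig: "\<zeta> \<in> eigenspace C T \<mu> \<longleftrightarrow> \<zeta> = (\<lambda>v. \<Sum>k\<in>L. ell2_inner (f k) \<zeta> * f k v)" for \<zeta>
    using eigenspace_iff[OF assms] by (simp add: L_def)
  have inner_P: "ell2_inner (f k) P = ell2_inner (f k) \<xi>" if "k \<in> L" for k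
    unfolding P_def using inner_f_combination[OF _ L] that L by auto
  have diff: "ell2_inner (f k) (\<lambda>v. \<xi> v - \<eta> v) = ell2_inner (f k) \<xi> - ell2_inner (f k) \<eta>" for k \<eta>
    by (simp add: inner_f sum_subtractf algebra_simps)
  show ?thesis
    unfolding orth_proj_def L_def[symmetric] P_def[symmetric]
  proof (rule the_equality, intro conjI ballI)
    show "P \<in> eigenspace C T \<mu>"
      unfolding eig by (subst P_def) (use inner_P in auto)
    fix \<zeta> assume "\<zeta> \<in> eigenspace C T \<mu>"
    then have \<zeta>: "\<zeta> v = (\<Sum>k\<in>L. ell2_inner (f k) \<zeta> * f k v)" for v using eig by metis
    have "ell2_inner \<zeta> (\<lambda>v. \<xi> v - P v) = (\<Sum>v\<in>F. cnj (\<zeta> v) * (\<xi> v - P v))"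
      by (rule ell2_inner_finite_left[OF finite(1)]) (subst \<zeta>, simp add: f_outside)
    also have "\<dots> = (\<Sum>v\<in>F. \<Sum>k\<in>L. cnj (ell2_inner (f k) \<zeta>) * (cnj (f k v) * (\<xi> v - P v)))"
      by (subst \<zeta>) (simp add: sum_distrib_right mult.assoc)
    also have "\<dots> = (\<Sum>k\<in>L. cnj (ell2_inner (f k) \<zeta>) * ell2_inner (f k) (\<lambda>v. \<xi> v - P v))"
      by (subst sum.swap) (simp add: inner_f sum_distrib_left)
    also have "\<dots> = 0" using inner_P by (simp add: diff)
    finally show "ell2_inner \<zeta> (\<lambda>v. \<xi> v - P v) = 0" .
  next
    fix \<eta> assume \<eta>: "\<eta> \<in> eigenspace C T \<mu> \<and> (\<forall>\<zeta>\<in>eigenspace C T \<mu>. ell2_inner \<zeta> (\<lambda>v. \<xi> v - \<eta> v) = 0)"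
    \<comment> \<open>Uniqueness of the projection: testing a competitor \<open>\<eta>\<close>
      against these vectors of the eigenspace determines all its coefficients.\<close>
    have "f k \<in> eigenspace C T \<mu>" if k: "k \<in> L" for k
    proof -
      have "f k v = (\<Sum>l\<in>L. ell2_inner (f l) (f k) * f l v)" for v
      proof -
        have "(\<Sum>l\<in>L. ell2_inner (f l) (f k) * f l v) = (\<Sum>l\<in>L. if k = l then f l v else 0)"
          unfolding inner_f by (intro sum.cong refl) (use k L in \<open>auto simp: f_orthonormal subset_iff\<close>)
        then show ?thesis using k finite_subset[OF L finite(3)] by simp
      qed
      then show ?thesis unfolding eig by blast
    qed
    then have "ell2_inner (f k) \<eta> = ell2_inner (f k) \<xi>" if "k \<in> L" for k
      using \<eta> that diff[of k \<eta>] by auto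
    moreover have "\<eta> = (\<lambda>v. \<Sum>k\<in>L. ell2_inner (f k) \<eta> * f k v)" using \<eta> eig by blast
    ultimately show "\<eta> = P" unfolding P_def by (metis (no_types, lifting) sum.cong)
  qed
qed

text \<open>The sum over all positive reals reduces to the finitely many values of the squared
  moduli of \<open>\<sigma>\<close>. Several indices may share a value, so the sum is regrouped by
  fibres.\<close>

lemma pos_op_power_T:
  "pos_op_power C T s \<xi> v = (\<Sum>k\<in>K. of_real (((cmod (\<sigma> k))\<^sup>2) powr s) * (ell2_inner (f k) \<xi> * f k v))"
proof -
  let ?ev = "\<lambda>k. (cmod (\<sigma> k))\<^sup>2"
  let ?t = "\<lambda>\<mu>. of_real (\<mu> powr s) * (\<Sum>k\<in>{k \<in> K. ?ev k = \<mu>}. ell2_inner (f k) \<xi> * f k v)"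
  have "pos_op_power C T s \<xi> v = (\<Sum>\<^sub>\<infinity>\<mu>\<in>?ev ` K. ?t \<mu>)"
    unfolding pos_op_power_def
  proof (rule infsum_cong_neutral)
    fix \<mu> assume "\<mu> \<in> {0<..} - ?ev ` K"
    then have "{k \<in> K. ?ev k = \<mu>} = {}" "\<mu> > 0" by auto
    then show "of_real (\<mu> powr s) * orth_proj (eigenspace C T \<mu>) \<xi> v = 0"
      by (simp only: orth_proj_eigenspace) simp
  qed (use nonzero in \<open>auto simp: orth_proj_eigenspace\<close>)
  also have "\<dots> = (\<Sum>\<mu>\<in>?ev ` K. ?t \<mu>)" using finite(3) by simp
  also have "\<dots> = (\<Sum>\<mu>\<in>?ev ` K. \<Sum>k\<in>{k \<in> K. ?ev k = \<mu>}. of_real (?ev k powr s) * (ell2_inner (f k) \<xi> * f k v))"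
    unfolding sum_distrib_left by (intro sum.cong refl) auto
  also have "\<dots> = (\<Sum>k\<in>K. of_real (?ev k powr s) * (ell2_inner (f k) \<xi> * f k v))"
    using sum.image_gen[OF finite(3), of "\<lambda>k. of_real (?ev k powr s) * (ell2_inner (f k) \<xi> * f k v)" "?ev"] by simp
  finally show ?thesis .
qed

lemma op_trace_pos_op_power: "op_trace C (pos_op_power C T s) = of_real (\<Sum>k\<in>K. ((cmod (\<sigma> k))\<^sup>2) powr s)"
proof -
  have diag: "ell2_inner (basis_vec c) (pos_op_power C T s (basis_vec c))
    = (\<Sum>k\<in>K. of_real (((cmod (\<sigma> k))\<^sup>2) powr s) * (cnj (f k c) * f k c))" for c
    by (simp add: ell2_inner_basis_vec pos_op_power_T inner_f_basis_vec)
  have "op_trace C (pos_op_power C T s)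
      = (\<Sum>\<^sub>\<infinity>c\<in>F. \<Sum>k\<in>K. of_real (((cmod (\<sigma> k))\<^sup>2) powr s) * (cnj (f k c) * f k c))"
    unfolding op_trace_def diag by (rule infsum_cong_neutral) (use F f_outside in auto)
  also have "\<dots> = (\<Sum>k\<in>K. of_real (((cmod (\<sigma> k))\<^sup>2) powr s) * (\<Sum>c\<in>F. cnj (f k c) * f k c))"
    using finite(1) unfolding sum_distrib_left by (simp, subst sum.swap) simp
  also have "\<dots> = of_real (\<Sum>k\<in>K. ((cmod (\<sigma> k))\<^sup>2) powr s)"
    by (simp add: f_orthonormal)
  finally show ?thesis .
qed

lemma schatten_norm_ereal:
  assumes "0 < p"
  shows "schatten_norm (ereal p) C x = (\<Sum>k\<in>K. cmod (\<sigma> k) powr p) powr (1 / p)"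
proof -
  have "((cmod (\<sigma> k))\<^sup>2) powr (p / 2) = cmod (\<sigma> k) powr p" if "k \<in> K" for k
    using nonzero[OF that] by (simp add: powr_powr flip: powr_numeral)
  then show ?thesis
    by (simp add: schatten_norm_def op_trace_pos_op_power del: o_apply)
qed

section \<open>The operator norm and the singular values\<close>

lemma ell2_norm_x: "(ell2_norm (x \<xi>))\<^sup>2 = (\<Sum>k\<in>K. (cmod (\<sigma> k))\<^sup>2 * (cmod (ell2_inner (f k) \<xi>))\<^sup>2)"
proof -
  have "(ell2_norm (x \<xi>))\<^sup>2 = (\<Sum>v\<in>G. (cmod (x \<xi> v))\<^sup>2)"
    by (subst ell2_norm_finite[OF finite(2)]) (simp_all add: decomp g_outside sum_nonneg)
  then have "complex_of_real ((ell2_norm (x \<xi>))\<^sup>2) = (\<Sum>v\<in>G. cnj (x \<xi> v) * x \<xi> v)"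
    by (simp add: of_real_cmod_square mult.commute)
  also have "\<dots> = (\<Sum>k\<in>K. cnj (\<sigma> k * ell2_inner (f k) \<xi>) * (\<sigma> k * ell2_inner (f k) \<xi>))"
    unfolding decomp by (rule inner_combination[OF finite(2) g_outside g_orthonormal])
  also have "\<dots> = of_real (\<Sum>k\<in>K. (cmod (\<sigma> k))\<^sup>2 * (cmod (ell2_inner (f k) \<xi>))\<^sup>2)"
    unfolding of_real_sum of_real_mult complex_norm_square
    by (intro sum.cong refl) (simp add: algebra_simps)
  finally show ?thesis using of_real_eq_iff by blast
qed

text \<open>The squared distance on \<open>F\<close> from \<open>\<xi>\<close> to its projection
  \<open>P\<close> is nonnegative and equals the difference of the two sides.\<close>

lemma bessel: "(\<Sum>k\<in>K. (cmod (ell2_inner (f k) \<xi>))\<^sup>2) \<le> (\<Sum>v\<in>F. (cmod (\<xi> v))\<^sup>2)"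
proof -
  define P where "P v = (\<Sum>k\<in>K. ell2_inner (f k) \<xi> * f k v)" for v
  have PP: "(\<Sum>v\<in>F. cnj (P v) * P v) = (\<Sum>k\<in>K. cnj (ell2_inner (f k) \<xi>) * ell2_inner (f k) \<xi>)"
    unfolding P_def by (rule inner_combination[OF finite(1) f_outside f_orthonormal])
  have P\<xi>: "(\<Sum>v\<in>F. cnj (P v) * \<xi> v) = (\<Sum>k\<in>K. cnj (ell2_inner (f k) \<xi>) * ell2_inner (f k) \<xi>)"
    unfolding P_def cnj_sum sum_distrib_right complex_cnj_mult
    by (subst sum.swap) (simp add: inner_f sum_distrib_left mult.assoc)
  have \<xi>P: "(\<Sum>v\<in>F. cnj (\<xi> v) * P v) = (\<Sum>k\<in>K. cnj (ell2_inner (f k) \<xi>) * ell2_inner (f k) \<xi>)"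
    using arg_cong[OF P\<xi>, of cnj] by (simp add: mult.commute)
  have "complex_of_real (\<Sum>v\<in>F. (cmod (\<xi> v - P v))\<^sup>2)
    = (\<Sum>v\<in>F. cnj (\<xi> v) * \<xi> v - cnj (P v) * \<xi> v - (cnj (\<xi> v) * P v - cnj (P v) * P v))"
    unfolding of_real_sum complex_norm_square
    by (intro sum.cong refl) (simp add: algebra_simps)
  also have "\<dots> = (\<Sum>v\<in>F. cnj (\<xi> v) * \<xi> v) - (\<Sum>k\<in>K. cnj (ell2_inner (f k) \<xi>) * ell2_inner (f k) \<xi>)"
    unfolding sum_subtractf PP P\<xi> \<xi>P by simp
  also have "\<dots> = of_real ((\<Sum>v\<in>F. (cmod (\<xi> v))\<^sup>2) - (\<Sum>k\<in>K. (cmod (ell2_inner (f k) \<xi>))\<^sup>2))"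
    unfolding of_real_diff of_real_sum complex_norm_square by (simp add: mult.commute)
  finally have "(\<Sum>v\<in>F. (cmod (\<xi> v - P v))\<^sup>2)
    = (\<Sum>v\<in>F. (cmod (\<xi> v))\<^sup>2) - (\<Sum>k\<in>K. (cmod (ell2_inner (f k) \<xi>))\<^sup>2)"
    using of_real_eq_iff by blast
  moreover have "0 \<le> (\<Sum>v\<in>F. (cmod (\<xi> v - P v))\<^sup>2)" by (simp add: sum_nonneg)
  ultimately show ?thesis by simp
qed

lemma ell2_norm_x_le:
  assumes "\<And>k. k \<in> K \<Longrightarrow> cmod (\<sigma> k) \<le> m" "0 \<le> m" "\<xi> \<in> ell2 C" "ell2_norm \<xi> \<le> 1"
  shows "ell2_norm (x \<xi>) \<le> m"
proof -
  have "(ell2_norm (x \<xi>))\<^sup>2 \<le> (\<Sum>k\<in>K. m\<^sup>2 * (cmod (ell2_inner (f k) \<xi>))\<^sup>2)"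
    unfolding ell2_norm_x by (intro sum_mono mult_right_mono power_mono assms) auto
  also have "\<dots> \<le> m\<^sup>2 * (ell2_norm \<xi>)\<^sup>2"
    unfolding sum_distrib_left[symmetric]
    by (intro mult_left_mono order.trans[OF bessel] sum_le_ell2_norm[OF assms(3) finite(1)]) auto
  also have "\<dots> \<le> m\<^sup>2"
  proof -
    have "0 \<le> ell2_norm \<xi>" by (simp add: ell2_norm_def infsum_nonneg)
    then show ?thesis using assms(4) by (simp add: mult_left_le power_le_one)
  qed
  finally show ?thesis using assms(2) by (rule power2_le_imp_le)
qed

lemma op_norm_le:
  assumes "\<And>k. k \<in> K \<Longrightarrow> cmod (\<sigma> k) \<le> m" "0 \<le> m"
  shows "op_norm C x \<le> m"
  unfolding op_norm_def
proof (rule cSUP_least)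
  have "(\<lambda>v. 0) \<in> {\<xi> \<in> ell2 C. ell2_norm \<xi> \<le> 1}" by (simp add: ell2_def ell2_norm_def)
  then show "{\<xi> \<in> ell2 C. ell2_norm \<xi> \<le> 1} \<noteq> {}" by blast
qed (use ell2_norm_x_le[OF assms] in auto)

lemma op_norm_ge:
  assumes k: "k \<in> K"
  shows "cmod (\<sigma> k) \<le> op_norm C x"
proof -
  have "complex_of_real (\<Sum>v\<in>F. (cmod (f k v))\<^sup>2) = 1"
    using f_orthonormal[OF k k] by (simp add: of_real_cmod_square mult.commute)
  then have "(\<Sum>v\<in>F. (cmod (f k v))\<^sup>2) = 1" using of_real_eq_1_iff by blast
  then have norm: "ell2_norm (f k) = 1" by (simp add: ell2_norm_finite[OF finite(1) f_outside])
  have f: "f k \<in> ell2 C" by (rule ell2_finite_support[OF finite(1) F f_outside])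
  have "(ell2_norm (x (f k)))\<^sup>2 = (\<Sum>l\<in>K. if k = l then (cmod (\<sigma> l))\<^sup>2 else 0)"
    unfolding ell2_norm_x inner_f by (intro sum.cong refl) (use f_orthonormal k in auto)
  then have "(cmod (\<sigma> k))\<^sup>2 = (ell2_norm (x (f k)))\<^sup>2" using k finite(3) by simp
  then have "cmod (\<sigma> k) = ell2_norm (x (f k))"
    by (rule power2_eq_imp_eq) (simp_all add: ell2_norm_def infsum_nonneg)
  also have "\<dots> \<le> op_norm C x"
    unfolding op_norm_def
  proof (rule cSUP_upper)
    \<comment> \<open>The supremum needs some upper bound; the sum of the singular values is a crude
      one.\<close>
    show "bdd_above ((\<lambda>\<xi>. ell2_norm (x \<xi>)) ` {\<xi> \<in> ell2 C. ell2_norm \<xi> \<le> 1})"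
      by (rule bdd_aboveI2[of _ _ "\<Sum>k\<in>K. cmod (\<sigma> k)"], rule ell2_norm_x_le)
        (use finite(3) in \<open>auto intro: member_le_sum sum_nonneg\<close>)
  qed (use f norm in auto)
  finally show ?thesis .
qed

end

section \<open>Binomial series at the roots of unity\<close>

lemma cis_eq_1_iff: "cis x = 1 \<longleftrightarrow> (\<exists>n::int. x = of_int n * 2 * pi)"
proof
  assume "cis x = 1"
  then have "cos x = 1" by (simp add: complex_eq_iff)
  then show "\<exists>n::int. x = of_int n * 2 * pi" by (simp add: cos_one_2pi_int)
next
  assume "\<exists>n::int. x = of_int n * 2 * pi"
  then obtain n :: int where "x = 2 * pi * of_int n" by (auto simp: mult_ac)
  then show "cis x = 1" by (simp only: cis_multiple_2pi Ints_of_int)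
qed

text \<open>A geometric sum whose ratio has \<open>s\<close>-th power 1 and differs from 1 unless
  \<open>m = 0\<close>. Differences of exponents or indices call for an integer
  \<open>m\<close>.\<close>

lemma sum_roots_of_unity:
  fixes m :: int
  assumes "0 < s" "\<bar>m\<bar> < int s"
  shows "(\<Sum>k<s. cis (2 * pi * of_int m / s) ^ k) = (if m = 0 then of_nat s else 0)"
proof (cases "m = 0")
  case False
  have "cis (2 * pi * of_int m / s) \<noteq> 1"
  proof
    assume "cis (2 * pi * of_int m / s) = 1"
    then obtain n :: int where "2 * pi * of_int m / s = of_int n * 2 * pi" by (auto simp: cis_eq_1_iff)
    then have "real_of_int m = real_of_int (n * int s)" using assms by (simp add: field_simps)
    then have "m = n * int s" by linarith
    then have "\<bar>m\<bar> = \<bar>n\<bar> * int s" "n \<noteq> 0" using False by (auto simp: abs_mult)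
    then have "1 \<le> \<bar>n\<bar>" by linarith
    then have "int s \<le> \<bar>n\<bar> * int s" using mult_right_mono[of 1 "\<bar>n\<bar>" "int s"] by simp
    then show False using assms(2) \<open>\<bar>m\<bar> = \<bar>n\<bar> * int s\<close> by linarith
  qed
  moreover have "cis (2 * pi * of_int m / s) ^ s = 1"
    using assms by (simp add: Complex.DeMoivre cis_multiple_2pi)
  ultimately show ?thesis using False by (simp add: geometric_sum)
qed simp

text \<open>The \<open>s\<close>-th roots of \<open>cis \<theta>\<close>: the angles
  \<open>0\<close> and \<open>pi\<close> correspond to the signs 1 and -1 of the cycle.\<close>

definition shifted_root :: "nat \<Rightarrow> real \<Rightarrow> nat \<Rightarrow> complex" where
  "shifted_root s \<theta> k = cis ((2 * pi * real k + \<theta>) / real s)"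

lemma norm_shifted_root [simp]: "cmod (shifted_root s \<theta> k) = 1"
  by (simp add: shifted_root_def)

lemma shifted_root_power: "shifted_root s \<theta> k ^ s = cis \<theta>" if "0 < s"
proof -
  have "shifted_root s \<theta> k ^ s = cis (2 * pi * real k + \<theta>)"
    using that by (simp add: shifted_root_def Complex.DeMoivre)
  then show ?thesis by (simp add: cis_multiple_2pi flip: cis_mult)
qed

text \<open>Below \<open>s\<close> the sums do not see \<open>\<theta>\<close>. The first to do so
  have exponents \<open>s\<close> and 0, in either order: they are \<open>s\<close> times
  \<open>cis \<theta>\<close> or its conjugate.\<close>

lemma shifted_root_sum:
  assumes "i < s" "j < s"
  shows "(\<Sum>k<s. shifted_root s \<theta> k ^ i * cnj (shifted_root s \<theta> k) ^ j) = (if i = j then of_nat s else 0)"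
proof -
  let ?m = "int i - int j"
  have "shifted_root s \<theta> k ^ i * cnj (shifted_root s \<theta> k) ^ j
      = cis (of_int ?m * \<theta> / s) * cis (2 * pi * of_int ?m / s) ^ k" for k
    using assms by (simp add: shifted_root_def cis_cnj Complex.DeMoivre cis_mult field_simps)
  then have "(\<Sum>k<s. shifted_root s \<theta> k ^ i * cnj (shifted_root s \<theta> k) ^ j)
      = cis (of_int ?m * \<theta> / s) * (\<Sum>k<s. cis (2 * pi * of_int ?m / s) ^ k)"
    by (simp add: sum_distrib_left)
  also have "\<dots> = (if i = j then of_nat s else 0)"
    by (subst sum_roots_of_unity) (use assms in auto)
  finally show ?thesis .
qed

text \<open>The dual relation, summed over exponents instead of roots: \<open>\<theta>\<close>
  cancels in the quotient of two roots.\<close>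

lemma shifted_root_orthogonal:
  assumes "k < s" "l < s"
  shows "(\<Sum>j<s. cnj (shifted_root s \<theta> k) ^ j * shifted_root s \<theta> l ^ j) = (if k = l then of_nat s else 0)"
proof -
  let ?m = "int l - int k"
  have "cnj (shifted_root s \<theta> k) ^ j * shifted_root s \<theta> l ^ j = cis (2 * pi * of_int ?m / s) ^ j" for j
    unfolding power_mult_distrib[symmetric]
    by (simp add: shifted_root_def cis_cnj cis_mult diff_divide_distrib[symmetric] algebra_simps)
  then show ?thesis using sum_roots_of_unity[of s ?m] assms by auto
qed

section \<open>Power series in the radius\<close>

lemma gbinomial_nonzero:
  fixes h :: "'a :: field_char_0"
  assumes "\<And>i. i < s \<Longrightarrow> h \<noteq> of_nat i"
  shows "h gchoose s \<noteq> 0"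
  using assms by (simp add: gbinomial_prod_rev)

text \<open>With \<open>w = 1 + r z\<close>, the number \<open>cmod w powr (2 * h)\<close> is
  \<open>w powr h\<close> times its conjugate, so the Cauchy product of the binomial series with its
  conjugate converges to it.\<close>

lemma norm_power_binomial_sums:
  fixes z :: complex and h r :: real
  assumes "cmod z = 1" "0 < r" "r < 1"
  shows "(\<lambda>n. (\<Sum>i\<le>n. of_real (h gchoose i) * of_real (h gchoose (n - i)) * (z ^ i * cnj z ^ (n - i))) * of_real r ^ n)
    sums of_real (cmod (1 + of_real r * z) powr (2 * h))"
proof -
  define b where "b = (\<lambda>n. complex_of_real h gchoose n)"
  have b: "b n = of_real (h gchoose n)" for n by (simp add: b_def gbinomial_prod_rev)
  let ?a = "\<lambda>n. b n * (of_real r * z) ^ n"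
  \<comment> \<open>Convergence at a radius strictly between \<open>r\<close> and 1 gives the
    absolute convergence at \<open>r\<close> that the Cauchy product requires.\<close>
  let ?q = "(1 + r) / 2"
  have q: "0 < ?q" "?q < 1" "r < ?q" using assms by auto
  have sums: "?a sums (1 + of_real r * z) powr of_real h"
    unfolding b_def by (rule gen_binomial_complex) (use assms in \<open>simp add: norm_mult\<close>)
  have "summable (\<lambda>n. b n * of_real ?q ^ n)"
    unfolding b_def by (rule sums_summable, rule gen_binomial_complex)
      (use q in \<open>simp only: norm_of_real abs_of_pos\<close>)
  then have abs: "summable (\<lambda>n. norm (?a n))"
    by (rule powser_insidea) (use q assms in \<open>simp only: norm_mult norm_of_real abs_of_pos mult_1_right\<close>)
  have cnj: "cnj (?a n) = b n * (of_real r * cnj z) ^ n" for n by (simp add: b)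
  have cnj_sums: "(\<lambda>n. cnj (?a n)) sums cnj ((1 + of_real r * z) powr of_real h)"
    using sums by (simp only: sums_cnj)
  have cnj_abs: "summable (\<lambda>n. norm (cnj (?a n)))" using abs by (simp only: complex_mod_cnj)
  have "(\<lambda>n. \<Sum>i\<le>n. ?a i * cnj (?a (n - i))) sums
      ((1 + of_real r * z) powr of_real h * cnj ((1 + of_real r * z) powr of_real h))"
    using Cauchy_product_sums[OF abs cnj_abs]
    unfolding sums_unique[OF sums, symmetric] sums_unique[OF cnj_sums, symmetric] .
  moreover have "(\<Sum>i\<le>n. ?a i * cnj (?a (n - i)))
    = (\<Sum>i\<le>n. of_real (h gchoose i) * of_real (h gchoose (n - i)) * (z ^ i * cnj z ^ (n - i))) * of_real r ^ n" for n
    unfolding sum_distrib_right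
  proof (rule sum.cong[OF refl])
    fix i assume "i \<in> {..n}"
    then have "complex_of_real r ^ n = of_real r ^ i * of_real r ^ (n - i)" by (simp flip: power_add)
    then show "?a i * cnj (?a (n - i))
      = of_real (h gchoose i) * of_real (h gchoose (n - i)) * (z ^ i * cnj z ^ (n - i)) * of_real r ^ n"
      unfolding cnj b by (simp add: power_mult_distrib)
  qed
  moreover have "(1 + of_real r * z) powr of_real h * cnj ((1 + of_real r * z) powr of_real h)
    = of_real (cmod (1 + of_real r * z) powr (2 * h))"
  proof -
    have "cmod ((1 + of_real r * z) powr of_real h) = cmod (1 + of_real r * z) powr h"
      by (simp add: norm_powr_real_powr')
    then have "(cmod ((1 + of_real r * z) powr of_real h))\<^sup>2 = cmod (1 + of_real r * z) powr (2 * h)"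
      by (simp add: power2_eq_square flip: powr_add)
    then show ?thesis by (metis complex_norm_square)
  qed
  ultimately show ?thesis by simp
qed

text \<open>Division by \<open>r ^ s\<close> makes \<open>d s\<close> the constant term, which is
  the limit of the series at 0. The sum is known only for real \<open>r\<close> between 0 and 1, so
  the limit is taken from the right.\<close>

lemma powser_eq_0_coeff:
  fixes d :: "nat \<Rightarrow> 'a :: {real_normed_field, banach}"
  assumes sums: "\<And>r. 0 < r \<Longrightarrow> r < 1 \<Longrightarrow> (\<lambda>n. d n * of_real r ^ n) sums 0"
    and low: "\<And>n. n < s \<Longrightarrow> d n = 0"
  shows "d s = 0"
proof -
  have shifted: "(\<lambda>n. d (n + s) * of_real r ^ n) sums 0" if r: "0 < r" "r < 1" for r
  proof -
    have "(\<lambda>n. d (n + s) * of_real r ^ (n + s)) sums (0 - (\<Sum>n<s. d n * of_real r ^ n))"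
      using sums[OF r] by (rule sums_split_initial_segment)
    moreover have "d (n + s) * of_real r ^ (n + s) = of_real r ^ s * (d (n + s) * of_real r ^ n)" for n
      by (simp add: power_add mult.left_commute mult.commute)
    moreover have "(\<Sum>n<s. d n * of_real r ^ n) = 0" using low by simp
    ultimately have "(\<lambda>n. of_real r ^ s * (d (n + s) * of_real r ^ n)) sums (of_real r ^ s * 0)" by simp
    moreover have "of_real r ^ s \<noteq> (0 :: 'a)" using r by simp
    ultimately show ?thesis by (metis sums_mult_D mult_zero_right sums_mult_iff)
  qed
  define f where "f z = (\<Sum>n. d (n + s) * z ^ n)" for z
  have "(\<lambda>n. d (n + s) * z ^ n) sums f z" if "norm z < 1/2" for z
  proof -
    \<comment> \<open>Convergence at the real point 1/2 gives absolute convergence in the open disc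
      of that radius.\<close>
    have "summable (\<lambda>n. norm (d (n + s) * z ^ n))"
      by (rule powser_insidea[OF sums_summable[OF shifted[of "1/2"]]]) (use that in auto)
    then show ?thesis unfolding f_def by (rule summable_sums[OF summable_norm_cancel])
  qed
  then have "(f \<longlongrightarrow> d (0 + s)) (at 0)"
    by (intro powser_limit_0[where s = "1/2" and a = "\<lambda>n. d (n + s)"]) auto
  moreover have "filterlim (\<lambda>r. of_real r :: 'a) (at 0) (at_right 0)"
    by (auto simp: filterlim_at eventually_at_filter intro!: tendsto_eq_intros)
  ultimately have "((\<lambda>r. f (of_real r)) \<longlongrightarrow> d s) (at_right 0)"
    by (simp add: filterlim_compose)
  moreover have "\<forall>\<^sub>F r in at_right 0. f (of_real r) = 0"
    using eventually_at_right_less[of 0] eventually_at_right_real[of 0 1]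
    by (auto elim!: eventually_mono simp: f_def dest!: shifted intro: sums_unique[symmetric])
  ultimately have "((\<lambda>r. 0) \<longlongrightarrow> d s) (at_right (0::real))"
    by (rule Lim_transform_eventually)
  then show ?thesis by (simp add: tendsto_const_iff)
qed

text \<open>If the two sums agreed for all \<open>r\<close>, the power series of their difference
  would vanish. Its coefficients below \<open>s\<close> are 0, hence so would be the one at
  \<open>s\<close>.\<close>

lemma ex_sum_norm_power_neq:
  fixes h :: real
  assumes s: "2 \<le> s" and h: "\<And>i::nat. h \<noteq> real i"
  shows "\<exists>r. 0 < r \<and> r < 1 \<and>
    (\<Sum>k<s. cmod (1 + of_real r * shifted_root s 0 k) powr (2 * h)) \<noteq>
    (\<Sum>k<s. cmod (1 + of_real r * shifted_root s pi k) powr (2 * h))"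
proof (rule ccontr)
  assume neg: "\<not> ?thesis"
  define w where "w i n = complex_of_real (h gchoose i) * of_real (h gchoose (n - i))" for i n
  define S where "S \<theta> i j = (\<Sum>k<s. shifted_root s \<theta> k ^ i * cnj (shifted_root s \<theta> k) ^ j)" for \<theta> i j
  define c where "c \<theta> n = (\<Sum>i\<le>n. w i n * S \<theta> i (n - i))" for \<theta> n
  have c_sums: "(\<lambda>n. c \<theta> n * of_real r ^ n) sums of_real (\<Sum>k<s. cmod (1 + of_real r * shifted_root s \<theta> k) powr (2 * h))"
    if r: "0 < r" "r < 1" for r \<theta>
  proof -
    have "(\<lambda>n. \<Sum>k<s. (\<Sum>i\<le>n. w i n * (shifted_root s \<theta> k ^ i * cnj (shifted_root s \<theta> k) ^ (n - i))) * of_real r ^ n)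
      sums (\<Sum>k<s. of_real (cmod (1 + of_real r * shifted_root s \<theta> k) powr (2 * h)))"
      unfolding w_def by (intro sums_sum norm_power_binomial_sums r) simp
    moreover have "(\<Sum>k<s. (\<Sum>i\<le>n. w i n * (shifted_root s \<theta> k ^ i * cnj (shifted_root s \<theta> k) ^ (n - i))) * of_real r ^ n)
      = c \<theta> n * of_real r ^ n" for n
      unfolding sum_distrib_right[symmetric] c_def S_def sum_distrib_left by (subst sum.swap) simp
    ultimately show ?thesis by simp
  qed
  have S_low: "S \<theta> i j = (if i = j then of_nat s else 0)" if "i < s" "j < s" for \<theta> i j
    unfolding S_def by (rule shifted_root_sum[OF that])
  have S_top: "S \<theta> s 0 = of_nat s * cis \<theta>" "S \<theta> 0 s = of_nat s * cnj (cis \<theta>)" for \<theta>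
    using s by (simp_all add: S_def shifted_root_power flip: complex_cnj_power)
  define d where "d n = c 0 n - c pi n" for n
  have "d s = 0"
  proof (rule powser_eq_0_coeff)
    show "(\<lambda>n. d n * of_real r ^ n) sums 0" if r: "0 < r" "r < 1" for r
      using sums_diff[OF c_sums[OF r, of 0] c_sums[OF r, of pi]] neg r
      by (auto simp: d_def left_diff_distrib simp del: of_real_sum)
    show "d n = 0" if "n < s" for n
      unfolding d_def c_def using that by (simp add: S_low)
  qed
  \<comment> \<open>Only the summands \<open>i = 0\<close> and \<open>i = s\<close> depend on
    \<open>\<theta>\<close>; together they are \<open>2 * s * cos \<theta>\<close> times the
    binomial coefficient.\<close>
  moreover have "d s = 4 * of_nat s * of_real (h gchoose s)"
  proof -
    have split: "c \<theta> s = w 0 s * S \<theta> 0 s + w s s * S \<theta> s 0 + (\<Sum>i\<in>{0<..<s}. w i s * S \<theta> i (s - i))" for \<theta>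
    proof -
      have "{..s} = insert 0 (insert s {0<..<s})" using s by auto
      then show ?thesis using s by (simp add: c_def)
    qed
    have "(\<Sum>i\<in>{0<..<s}. w i s * S 0 i (s - i)) = (\<Sum>i\<in>{0<..<s}. w i s * S pi i (s - i))"
      by (intro sum.cong refl) (simp add: S_low)
    then show ?thesis by (simp add: d_def split S_top w_def algebra_simps)
  qed
  moreover have "h gchoose s \<noteq> 0" by (rule gbinomial_nonzero) (rule h)
  ultimately show False using s by simp
qed

section \<open>The matrix of a cycle\<close>

text \<open>The Fourier vectors with entries \<open>\<omega> ^ j / sqrt s\<close>, placed on columns
  for \<open>f\<close> and on rows for \<open>g\<close>, diagonalize the twisted shift: its corner
  entry \<open>cis \<theta>\<close> is \<open>\<omega> ^ s\<close>. The values are nonzero since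
  \<open>\<rho> < 1\<close>.\<close>

lemma singular_decomposition_cycle:
  fixes C :: "'v set" and x :: "'v op" and r c :: "nat \<Rightarrow> 'v"
  assumes s: "0 < s" and inj: "inj_on r {..<s}" "inj_on c {..<s}" and C: "c ` {..<s} \<subseteq> C"
    and \<rho>: "0 < \<rho>" "\<rho> < 1"
    and x: "\<And>\<xi> v. x \<xi> v = (\<Sum>j<s. if v = r j
        then \<xi> (c j) + of_real \<rho> * (if Suc j < s then \<xi> (c (Suc j)) else cis \<theta> * \<xi> (c 0)) else 0)"
  shows "singular_decomposition C (c ` {..<s}) (r ` {..<s}) {..<s} (\<lambda>k. 1 + of_real \<rho> * shifted_root s \<theta> k)
    (\<lambda>k v. \<Sum>j<s. if v = c j then shifted_root s \<theta> k ^ j / sqrt s else 0)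
    (\<lambda>k v. \<Sum>j<s. if v = r j then shifted_root s \<theta> k ^ j / sqrt s else 0) x"
proof -
  let ?\<omega> = "shifted_root s \<theta>"
  let ?h = "\<lambda>(b :: nat \<Rightarrow> 'v) k v. \<Sum>j<s. if v = b j then ?\<omega> k ^ j / sqrt s else 0"
  \<comment> \<open>The vectors are functions of vertices written as sums over indices; injectivity
    of \<open>b\<close> selects a single summand.\<close>
  have at: "(\<Sum>j<s. if b i = b j then a j else 0) = a i"
    if "inj_on b {..<s}" "i < s" for b :: "nat \<Rightarrow> 'v" and a :: "nat \<Rightarrow> complex" and i
  proof -
    have "(\<Sum>j<s. if b i = b j then a j else 0) = (\<Sum>j<s. if i = j then a j else 0)"
      using that by (intro sum.cong refl) (auto dest: inj_onD)
    then show ?thesis using that by simp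
  qed
  have outside: "?h b k v = 0" if "v \<notin> b ` {..<s}" for b k v
    using that by (intro sum.neutral) auto
  have root: "complex_of_real (sqrt s) * complex_of_real (sqrt s) = of_nat s" "complex_of_real (sqrt s) \<noteq> 0"
    using s by (auto simp flip: of_real_mult)
  have orth: "(\<Sum>v\<in>b ` {..<s}. cnj (?h b k v) * ?h b l v) = (if k = l then 1 else 0)"
    if b: "inj_on b {..<s}" and kl: "k < s" "l < s" for b k l
  proof -
    have "(\<Sum>v\<in>b ` {..<s}. cnj (?h b k v) * ?h b l v) = (\<Sum>i<s. cnj (?\<omega> k) ^ i * ?\<omega> l ^ i / of_nat s)"
      unfolding sum.reindex[OF b] comp_def
      by (intro sum.cong refl) (simp add: at[OF b] root(1)[symmetric] del: cnj_sum)
    then show ?thesis using shifted_root_orthogonal[OF kl, of \<theta>] s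
      by (simp flip: sum_divide_distrib split: if_splits)
  qed
  have inner: "ell2_inner (?h c k) \<xi> = (\<Sum>i<s. cnj (?\<omega> k) ^ i * \<xi> (c i)) / sqrt s" for k \<xi>
  proof -
    have "ell2_inner (?h c k) \<xi> = (\<Sum>v\<in>c ` {..<s}. cnj (?h c k v) * \<xi> v)"
      by (rule ell2_inner_finite_left) (use outside in auto)
    also have "\<dots> = (\<Sum>i<s. cnj (?\<omega> k) ^ i * \<xi> (c i) / sqrt s)"
      unfolding sum.reindex[OF inj(2)] comp_def
      by (intro sum.cong refl) (simp add: at[OF inj(2)] del: cnj_sum)
    finally show ?thesis by (simp add: sum_divide_distrib)
  qed
  \<comment> \<open>Fourier inversion: summation over the roots recovers the entry at
    \<open>i\<close>.\<close>
  have S: "(\<Sum>k<s. ?\<omega> k ^ i * (\<Sum>j<s. cnj (?\<omega> k) ^ j * \<zeta> j)) = of_nat s * \<zeta> i" if "i < s" for i \<zeta>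
  proof -
    have "(\<Sum>k<s. ?\<omega> k ^ i * (\<Sum>j<s. cnj (?\<omega> k) ^ j * \<zeta> j))
      = (\<Sum>j<s. \<zeta> j * (\<Sum>k<s. ?\<omega> k ^ i * cnj (?\<omega> k) ^ j))"
      unfolding sum_distrib_left by (subst sum.swap) (simp add: mult_ac)
    also have "\<dots> = (\<Sum>j<s. if i = j then \<zeta> j * of_nat s else 0)"
      by (intro sum.cong refl) (use that in \<open>simp add: shifted_root_sum\<close>)
    finally show ?thesis using that by simp
  qed
  show ?thesis
  proof
    show "1 + of_real \<rho> * ?\<omega> k \<noteq> 0" for k
    proof
      assume "1 + of_real \<rho> * ?\<omega> k = 0"
      then have "of_real \<rho> * ?\<omega> k = -1" by (simp add: add_eq_0_iff)
      then have "cmod (of_real \<rho> * ?\<omega> k) = 1" by simp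
      then show False using \<rho> by (simp add: norm_mult)
    qed
    fix \<xi> v
    have row: "(\<Sum>k<s. (1 + of_real \<rho> * ?\<omega> k) * ell2_inner (?h c k) \<xi> * (?\<omega> k ^ j / sqrt s))
        = \<xi> (c j) + of_real \<rho> * (if Suc j < s then \<xi> (c (Suc j)) else cis \<theta> * \<xi> (c 0))" (is "?L = _")
      if j: "j < s" for j
    proof -
      have "?L = (\<Sum>k<s. ((\<Sum>i<s. cnj (?\<omega> k) ^ i * \<xi> (c i)) * ?\<omega> k ^ j
          + of_real \<rho> * ((\<Sum>i<s. cnj (?\<omega> k) ^ i * \<xi> (c i)) * ?\<omega> k ^ Suc j)) / of_nat s)"
        unfolding inner root(1)[symmetric] by (intro sum.cong refl) (simp add: field_simps)
      also have "\<dots> = ((\<Sum>k<s. ?\<omega> k ^ j * (\<Sum>i<s. cnj (?\<omega> k) ^ i * \<xi> (c i)))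
          + of_real \<rho> * (\<Sum>k<s. ?\<omega> k ^ Suc j * (\<Sum>i<s. cnj (?\<omega> k) ^ i * \<xi> (c i)))) / of_nat s"
        unfolding sum_divide_distrib[symmetric] sum.distrib sum_distrib_left[symmetric]
        by (simp only: mult.commute)
      also have "(\<Sum>k<s. ?\<omega> k ^ Suc j * (\<Sum>i<s. cnj (?\<omega> k) ^ i * \<xi> (c i)))
        = of_nat s * (if Suc j < s then \<xi> (c (Suc j)) else cis \<theta> * \<xi> (c 0))"
      proof (cases "Suc j < s")
        case True
        then show ?thesis using S[OF True, of "\<lambda>i. \<xi> (c i)"] by simp
      next
        case False
        \<comment> \<open>In the last row the power wraps around to \<open>cis \<theta>\<close>, and
          inversion is applied at index 0.\<close>
        then have "Suc j = s" using j by simp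
        then have pow: "?\<omega> k ^ Suc j = cis \<theta> * ?\<omega> k ^ 0" for k
          using shifted_root_power[OF s] by simp
        have "(\<Sum>k<s. ?\<omega> k ^ Suc j * (\<Sum>i<s. cnj (?\<omega> k) ^ i * \<xi> (c i)))
          = cis \<theta> * (\<Sum>k<s. ?\<omega> k ^ 0 * (\<Sum>i<s. cnj (?\<omega> k) ^ i * \<xi> (c i)))"
          unfolding pow mult.assoc sum_distrib_left[symmetric] ..
        then show ?thesis using S[OF s, of "\<lambda>i. \<xi> (c i)"] False by simp
      qed
      also have "(\<Sum>k<s. ?\<omega> k ^ j * (\<Sum>i<s. cnj (?\<omega> k) ^ i * \<xi> (c i))) = of_nat s * \<xi> (c j)"
        by (rule S[OF j])
      also have "(of_nat s * a + of_real \<rho> * (of_nat s * b)) / of_nat s = a + of_real \<rho> * b" for a b :: complex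
        using s by (simp add: field_simps)
      finally show ?thesis .
    qed
    have "(\<Sum>k<s. (1 + of_real \<rho> * ?\<omega> k) * ell2_inner (?h c k) \<xi> * ?h r k v)
      = (\<Sum>k<s. \<Sum>j<s. if v = r j then (1 + of_real \<rho> * ?\<omega> k) * ell2_inner (?h c k) \<xi> * (?\<omega> k ^ j / sqrt s) else 0)"
      unfolding sum_distrib_left by (intro sum.cong refl) simp
    also have "\<dots> = (\<Sum>j<s. if v = r j then
        (\<Sum>k<s. (1 + of_real \<rho> * ?\<omega> k) * ell2_inner (?h c k) \<xi> * (?\<omega> k ^ j / sqrt s)) else 0)"
      by (subst sum.swap) (intro sum.cong refl, simp)
    also have "\<dots> = x \<xi> v"
      unfolding x by (intro sum.cong refl) (simp only: row lessThan_iff)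
    finally show "x \<xi> v = (\<Sum>k<s. (1 + of_real \<rho> * ?\<omega> k) * ell2_inner (?h c k) \<xi> * ?h r k v)" ..
  qed (use C orth[OF inj(1)] orth[OF inj(2)] outside in \<open>simp_all del: cnj_sum\<close>)
qed

text \<open>Summation over a superset of the support avoids asking which of the prescribed entries
  are nonzero.\<close>

lemma matrix_sum_superset:
  assumes "finite A" "A \<subseteq> I" "\<And>q. q \<in> I - A \<Longrightarrow> a q = 0"
  shows "matrix_sum I a \<xi> v = (\<Sum>(r, c)\<in>A. if v = r then a (r, c) * \<xi> c else 0)"
  unfolding matrix_sum_def
  by (rule sum.mono_neutral_cong_left) (use assms in \<open>auto simp: elementary_matrix_def basis_vec_def split: if_splits\<close>)

text \<open>The matrix \<open>1 + \<rho> U\<close> with \<open>U\<close> the cyclic shift of order \<open>s\<close>, one of whose entries has been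
  multiplied by \<open>\<epsilon>\<close>, so that \<open>U\<^sup>s = \<epsilon>\<close>.\<close>

definition cycle_coeff ::
    "nat \<Rightarrow> (nat \<Rightarrow> 'v) \<Rightarrow> (nat \<Rightarrow> 'v) \<Rightarrow> real \<Rightarrow> real \<Rightarrow> 'v \<times> 'v \<Rightarrow> complex" where
  "cycle_coeff s r c \<rho> \<epsilon> q = (if q = (r (s - 1), c 0) then of_real (\<epsilon> * \<rho>)
    else if q \<in> (\<lambda>j. (r j, c j)) ` {..<s} then 1
    else if q \<in> (\<lambda>j. (r j, c (Suc j))) ` {..<s - 1} then of_real \<rho> else 0)"

lemma cycle_coeff_support:
  "{q \<in> I. cycle_coeff s r c \<rho> \<epsilon> q \<noteq> 0} \<subseteq>
    insert (r (s - 1), c 0) ((\<lambda>j. (r j, c j)) ` {..<s} \<union> (\<lambda>j. (r j, c (Suc j))) ` {..<s - 1})"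
  by (auto simp: cycle_coeff_def split: if_splits)

lemma matrix_sum_cycle:
  assumes s: "2 \<le> s" and inj: "inj_on r {..<s}" "inj_on c {..<s}"
    and I: "\<And>j. j < s \<Longrightarrow> (r j, c j) \<in> I" "\<And>j. Suc j < s \<Longrightarrow> (r j, c (Suc j)) \<in> I" "(r (s - 1), c 0) \<in> I"
  shows "matrix_sum I (cycle_coeff s r c \<rho> \<epsilon>) \<xi> v = (\<Sum>j<s. if v = r j
        then \<xi> (c j) + of_real \<rho> * (if Suc j < s then \<xi> (c (Suc j)) else of_real \<epsilon> * \<xi> (c 0)) else 0)"
proof -
  let ?D = "(\<lambda>j. (r j, c j)) ` {..<s}" and ?N = "(\<lambda>j. (r j, c (Suc j))) ` {..<s - 1}"
  let ?q = "(r (s - 1), c 0)" and ?a = "cycle_coeff s r c \<rho> \<epsilon>"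
  let ?t = "\<lambda>(r', c'). if v = r' then ?a (r', c') * \<xi> c' else 0"
  have r: "r i = r j \<longleftrightarrow> i = j" and c: "c i = c j \<longleftrightarrow> i = j" if "i < s" "j < s" for i j
    using inj that by (auto dest: inj_onD)
  \<comment> \<open>Corner, diagonal and superdiagonal positions are disjoint; for
    \<open>s = 1\<close> the corner would lie on the diagonal.\<close>
  have dis: "?q \<notin> ?D" "?q \<notin> ?N" "?D \<inter> ?N = {}"
    using s by (auto simp: r c)
  have injD: "inj_on (\<lambda>j. (r j, c j)) {..<s}" and injN: "inj_on (\<lambda>j. (r j, c (Suc j))) {..<s - 1}"
    by (auto simp: inj_on_def r)
  have "matrix_sum I ?a \<xi> v = sum ?t (insert ?q (?D \<union> ?N))"
  proof (rule matrix_sum_superset)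
    show "insert ?q (?D \<union> ?N) \<subseteq> I" using I by auto
    show "?a q = 0" if "q \<in> I - insert ?q (?D \<union> ?N)" for q
      using that by (simp add: cycle_coeff_def)
  qed simp
  also have "\<dots> = ?t ?q + (sum ?t ?D + sum ?t ?N)"
    using dis by (simp add: sum.union_disjoint)
  also have "sum ?t ?D = (\<Sum>j<s. if v = r j then \<xi> (c j) else 0)"
    unfolding sum.reindex[OF injD] comp_def
  proof (intro sum.cong refl)
    fix j assume "j \<in> {..<s}"
    then have "(r j, c j) \<in> ?D" by blast
    moreover from this have "(r j, c j) \<noteq> ?q" using dis by metis
    ultimately have "?a (r j, c j) = 1" unfolding cycle_coeff_def by auto
    then show "?t (r j, c j) = (if v = r j then \<xi> (c j) else 0)" by simp
  qed
  also have "sum ?t ?N = (\<Sum>j<s - 1. if v = r j then of_real \<rho> * \<xi> (c (Suc j)) else 0)"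
    unfolding sum.reindex[OF injN] comp_def
  proof (intro sum.cong refl)
    fix j assume "j \<in> {..<s - 1}"
    then have "(r j, c (Suc j)) \<in> ?N" by blast
    moreover from this have "(r j, c (Suc j)) \<noteq> ?q" "(r j, c (Suc j)) \<notin> ?D"
      using dis by (metis, blast)
    ultimately have "?a (r j, c (Suc j)) = of_real \<rho>" unfolding cycle_coeff_def by auto
    then show "?t (r j, c (Suc j)) = (if v = r j then of_real \<rho> * \<xi> (c (Suc j)) else 0)" by simp
  qed
  also have "?t ?q = (if v = r (s - 1) then of_real \<rho> * (of_real \<epsilon> * \<xi> (c 0)) else 0)"
    by (simp add: cycle_coeff_def mult.commute)
  finally have lhs: "matrix_sum I ?a \<xi> v = (if v = r (s - 1) then of_real \<rho> * (of_real \<epsilon> * \<xi> (c 0)) else 0)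
    + ((\<Sum>j<s. if v = r j then \<xi> (c j) else 0) + (\<Sum>j<s - 1. if v = r j then of_real \<rho> * \<xi> (c (Suc j)) else 0))" .
  \<comment> \<open>Splitting off the last row isolates the corner entry.\<close>
  obtain m where m: "s = Suc m" using s by (cases s) auto
  have "(\<Sum>j<s. if v = r j
        then \<xi> (c j) + of_real \<rho> * (if Suc j < s then \<xi> (c (Suc j)) else of_real \<epsilon> * \<xi> (c 0)) else 0)
    = (\<Sum>j<s. (if v = r j then \<xi> (c j) else 0) + (if v = r j then of_real \<rho> * (if Suc j < s then \<xi> (c (Suc j)) else of_real \<epsilon> * \<xi> (c 0)) else 0))"
    by (intro sum.cong refl) simp
  also have "\<dots> = (\<Sum>j<s. if v = r j then \<xi> (c j) else 0)
    + ((\<Sum>j<m. if v = r j then of_real \<rho> * \<xi> (c (Suc j)) else 0) + (if v = r m then of_real \<rho> * (of_real \<epsilon> * \<xi> (c 0)) else 0))"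
    unfolding sum.distrib by (simp add: m cong: if_cong)
  finally show ?thesis unfolding lhs by (simp add: m)
qed

text \<open>Flipping the sign of the corner entry alone would have to preserve the norm, but it
  replaces the roots of 1 by the roots of -1 in the singular values.\<close>

lemma not_unconditional_cycle:
  fixes C :: "'v set" and p :: ereal
  assumes s: "2 \<le> s" and inj: "inj_on r {..<s}" "inj_on c {..<s}" and C: "c ` {..<s} \<subseteq> C"
    and I: "\<And>j. j < s \<Longrightarrow> (r j, c j) \<in> I" "\<And>j. Suc j < s \<Longrightarrow> (r j, c (Suc j)) \<in> I" "(r (s - 1), c 0) \<in> I"
    and p: "0 < p" "p \<notin> {ereal (2 * real k) | k. k \<ge> 1}"
  shows "\<not> real_1_unconditional p C I"
proof
  assume unc: "real_1_unconditional p C I"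
  let ?x = "\<lambda>\<rho> \<epsilon>. matrix_sum I (cycle_coeff s r c \<rho> \<epsilon>)"
  let ?\<sigma> = "\<lambda>\<rho> \<theta> k. 1 + of_real \<rho> * shifted_root s \<theta> k"
  have "schatten_norm p C (?x \<rho> (-1)) = schatten_norm p C (?x \<rho> 1)" for \<rho>
  proof -
    let ?\<epsilon> = "\<lambda>q. if q = (r (s - 1), c 0) then -1 else 1 :: real"
    have "(\<lambda>q. of_real (?\<epsilon> q) * cycle_coeff s r c \<rho> 1 q) = cycle_coeff s r c \<rho> (-1)"
      by (auto simp: cycle_coeff_def)
    moreover have "finite {q \<in> I. cycle_coeff s r c \<rho> 1 q \<noteq> 0}"
      by (rule finite_subset[OF cycle_coeff_support]) simp
    ultimately show ?thesis
      using unc[unfolded real_1_unconditional_def, THEN spec[of _ ?\<epsilon>], THEN spec[of _ "cycle_coeff s r c \<rho> 1"]]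
      by simp
  qed note eq = this
  have pos: "0 < s" using s by simp
  have svd: "\<exists>f g. singular_decomposition C (c ` {..<s}) (r ` {..<s}) {..<s} (?\<sigma> \<rho> \<theta>) f g (?x \<rho> \<epsilon>)"
    if \<rho>: "0 < \<rho>" "\<rho> < 1" and \<epsilon>: "cis \<theta> = of_real \<epsilon>" for \<rho> \<theta> \<epsilon>
    by (intro exI, rule singular_decomposition_cycle[OF pos inj C \<rho>], unfold \<epsilon>, rule matrix_sum_cycle[OF s inj I])
  have svd0: "\<exists>f g. singular_decomposition C (c ` {..<s}) (r ` {..<s}) {..<s} (?\<sigma> \<rho> 0) f g (?x \<rho> 1)"
    if "0 < \<rho>" "\<rho> < 1" for \<rho> by (rule svd[OF that]) simp
  have svd1: "\<exists>f g. singular_decomposition C (c ` {..<s}) (r ` {..<s}) {..<s} (?\<sigma> \<rho> pi) f g (?x \<rho> (-1))"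
    if "0 < \<rho>" "\<rho> < 1" for \<rho> by (rule svd[OF that]) simp
  show False
  proof (cases p)
    case (real p')
    then have p': "0 < p'" using p by simp
    \<comment> \<open>The hypothesis on \<open>p\<close> excludes only \<open>i \<ge> 1\<close>; the
      case \<open>i = 0\<close> is excluded by \<open>p' > 0\<close>.\<close>
    have "p' / 2 \<noteq> real i" for i :: nat
    proof
      assume "p' / 2 = real i"
      then have "p' = 2 * real i" by simp
      moreover from this have "1 \<le> i" using p' by (cases i) auto
      ultimately show False using p(2) real by blast
    qed
    from ex_sum_norm_power_neq[OF s this] obtain \<rho> where \<rho>: "0 < \<rho>" "\<rho> < 1"
      and neq: "(\<Sum>k<s. cmod (?\<sigma> \<rho> 0 k) powr p') \<noteq> (\<Sum>k<s. cmod (?\<sigma> \<rho> pi k) powr p')" by auto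
    have "(\<Sum>k<s. cmod (?\<sigma> \<rho> 0 k) powr p') powr (1 / p') = (\<Sum>k<s. cmod (?\<sigma> \<rho> pi k) powr p') powr (1 / p')"
      using svd0[OF \<rho>] svd1[OF \<rho>] eq[of \<rho>] singular_decomposition.schatten_norm_ereal p' real by metis
    then have "((\<Sum>k<s. cmod (?\<sigma> \<rho> 0 k) powr p') powr (1 / p')) powr p'
      = ((\<Sum>k<s. cmod (?\<sigma> \<rho> pi k) powr p') powr (1 / p')) powr p'" by simp
    then show False using neq p' by (simp add: powr_powr sum_nonneg)
  next
    case PInf
    \<comment> \<open>For \<open>\<rho> = 1/2\<close> and sign 1, the root 1 gives the singular
      value 3/2. For sign -1 no root equals 1, so all of the finitely many singular values stay
      strictly below 3/2.\<close>
    obtain f g where "singular_decomposition C (c ` {..<s}) (r ` {..<s}) {..<s} (?\<sigma> (1/2) 0) f g (?x (1/2) 1)"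
      using svd0[of "1/2"] by auto
    then have "cmod (?\<sigma> (1/2) 0 0) \<le> op_norm C (?x (1/2) 1)"
      by (rule singular_decomposition.op_norm_ge) (use s in simp)
    then have ge: "3/2 \<le> op_norm C (?x (1/2) 1)" by (simp add: shifted_root_def)
    define m where "m = Max ((\<lambda>k. cmod (?\<sigma> (1/2) pi k)) ` {..<s})"
    have fin: "finite ((\<lambda>k. cmod (?\<sigma> (1/2) pi k)) ` {..<s})" "(\<lambda>k. cmod (?\<sigma> (1/2) pi k)) ` {..<s} \<noteq> {}"
      using s by (auto simp: lessThan_empty_iff)
    obtain f g where "singular_decomposition C (c ` {..<s}) (r ` {..<s}) {..<s} (?\<sigma> (1/2) pi) f g (?x (1/2) (-1))"
      using svd1[of "1/2"] by auto
    then have "op_norm C (?x (1/2) (-1)) \<le> m"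
    proof (rule singular_decomposition.op_norm_le)
      show le: "cmod (?\<sigma> (1/2) pi k) \<le> m" if "k \<in> {..<s}" for k
        unfolding m_def using that fin by (intro Max_ge) auto
      show "0 \<le> m" using le[of 0] s norm_ge_zero[of "?\<sigma> (1/2) pi 0"] by (simp del: norm_ge_zero)
    qed
    moreover have "m < 3/2"
      unfolding m_def Max_less_iff[OF fin]
    proof safe
      fix k assume "k < s"
      let ?\<omega> = "shifted_root s pi k"
      have "?\<omega> \<noteq> 1" using shifted_root_power[OF pos, of pi k] by auto
      moreover have unit: "(Re ?\<omega>)\<^sup>2 + (Im ?\<omega>)\<^sup>2 = 1"
        using norm_shifted_root[of s pi k] by (simp add: cmod_def)
      ultimately have "Re ?\<omega> < 1"
      proof -
        have "Re ?\<omega> \<le> 1" using complex_Re_le_cmod[of ?\<omega>] by simp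
        moreover have "Re ?\<omega> \<noteq> 1" using unit \<open>?\<omega> \<noteq> 1\<close> by (auto simp: complex_eq_iff)
        ultimately show ?thesis by simp
      qed
      have "(cmod (?\<sigma> (1/2) pi k))\<^sup>2 = 1 + Re ?\<omega> + ((Re ?\<omega>)\<^sup>2 + (Im ?\<omega>)\<^sup>2) / 4"
        unfolding cmod_power2 by (simp add: power2_eq_square field_simps)
      also have "\<dots> < (3/2)\<^sup>2" unfolding unit using \<open>Re ?\<omega> < 1\<close> by (simp add: power2_eq_square)
      finally show "cmod (?\<sigma> (1/2) pi k) < 3/2" by (rule power2_less_imp_less) simp
    qed
    ultimately show False using ge eq[of "1/2"] PInf by (simp add: schatten_norm_def)
  qed (use p in auto)
qed

text \<open>Vertices alternate between the classes. Read periodically from a vertex in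
  \<open>C\<close>, the cycle has its columns at even offsets and its rows at odd ones.\<close>

lemma bipartite_cycle_alternates:
  fixes I :: "('v \<times> 'v) set"
  assumes I: "I \<subseteq> R \<times> C" "R \<inter> C = {}" and cyc: "is_cycle (bipartite_edges I) vs"
  obtains s and r c :: "nat \<Rightarrow> 'v" where "2 \<le> s" "inj_on r {..<s}" "inj_on c {..<s}" "c ` {..<s} \<subseteq> C"
    "\<And>j. j < s \<Longrightarrow> (r j, c j) \<in> I" "\<And>j. Suc j < s \<Longrightarrow> (r j, c (Suc j)) \<in> I" "(r (s - 1), c 0) \<in> I"
proof -
  let ?n = "length vs"
  define u where "u i = vs ! (i mod ?n)" for i
  have n: "4 \<le> ?n" "distinct vs" using cyc by (auto simp: is_cycle_def)
  have "{u i, u (Suc i)} \<in> bipartite_edges I" for i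
  proof -
    have "i mod ?n < ?n" using n by (intro mod_less_divisor) auto
    then have "{vs ! (i mod ?n), vs ! ((i mod ?n + 1) mod ?n)} \<in> bipartite_edges I"
      using cyc unfolding is_cycle_def by blast
    then show ?thesis by (simp add: u_def mod_simps)
  qed
  then have edge: "(u i, u (Suc i)) \<in> I \<or> (u (Suc i), u i) \<in> I" for i
    by (auto simp: bipartite_edges_def doubleton_eq_iff)
  then have CR: "u i \<in> C \<Longrightarrow> (u (Suc i), u i) \<in> I \<and> u (Suc i) \<in> R"
    and RC: "u i \<in> R \<Longrightarrow> (u i, u (Suc i)) \<in> I \<and> u (Suc i) \<in> C" for i
    using I by blast+
  \<comment> \<open>the cycle may start in either vertex class\<close>
  obtain m where m: "u m \<in> C" "m \<le> 1"
    using edge[of 0] I(1) by (metis One_nat_def SigmaE2 le_numeral_extra(4) subset_iff zero_le_one)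
  have even: "u (m + 2 * j) \<in> C" for j
    by (induction j) (use m CR RC in auto)
  have odd: "u (m + 2 * j + 1) \<in> R" for j using CR[OF even] by simp
  have per: "u (i + ?n) = u i" for i by (simp add: u_def)
  \<comment> \<open>After one full turn of odd length the starting vertex would lie in
    \<open>R\<close>.\<close>
  have "even ?n"
  proof (rule ccontr)
    assume "odd ?n"
    then obtain j where "?n = 2 * j + 1" by (elim oddE)
    then have "u m \<in> R" using odd[of j] per[of m] by (simp add: add.assoc)
    then show False using m I(2) by blast
  qed
  then obtain s where s: "?n = 2 * s" by (elim evenE)
  have u_inj: "i = j" if "u i = u j" "m \<le> i" "i < m + ?n" "m \<le> j" "j < m + ?n" for i j
  proof -
    have "i mod ?n < ?n" "j mod ?n < ?n" using n by (auto intro!: mod_less_divisor)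
    then have "i mod ?n = j mod ?n" using that(1) n(2) by (simp add: u_def nth_eq_iff_index_eq)
    \<comment> \<open>Subtraction of naturals truncates, so both differences are considered: each is
      divisible by \<open>?n\<close> and smaller than \<open>?n\<close>, hence 0.\<close>
    then have "?n dvd i - j" "?n dvd j - i" by (metis diff_is_0_eq dvd_0_right mod_eq_dvd_iff_nat nle_le)+
    moreover have "i - j < ?n" "j - i < ?n" using that(2-5) by linarith+
    ultimately show ?thesis by (metis diffs0_imp_equal nat_dvd_not_less neq0_conv)
  qed
  show ?thesis
  proof
    show "2 \<le> s" using n s by simp
    show "inj_on (\<lambda>j. u (m + 2 * j + 1)) {..<s}"
    proof (rule inj_onI)
      fix i j assume "i \<in> {..<s}" "j \<in> {..<s}" "u (m + 2 * i + 1) = u (m + 2 * j + 1)"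
      then show "i = j" using u_inj[of "m + 2 * i + 1" "m + 2 * j + 1"] s by auto
    qed
    show "inj_on (\<lambda>j. u (m + 2 * j)) {..<s}"
    proof (rule inj_onI)
      fix i j assume "i \<in> {..<s}" "j \<in> {..<s}" "u (m + 2 * i) = u (m + 2 * j)"
      then show "i = j" using u_inj[of "m + 2 * i" "m + 2 * j"] s by auto
    qed
    show "(\<lambda>j. u (m + 2 * j)) ` {..<s} \<subseteq> C" using even by blast
    show "(u (m + 2 * j + 1), u (m + 2 * j)) \<in> I" for j using CR[OF even, of j] by simp
    show "(u (m + 2 * j + 1), u (m + 2 * Suc j)) \<in> I" for j using RC[OF odd, of j] by simp
    have "m + 2 * (s - 1) + 2 = m + ?n" using s n by arith
    then have "u (m + 2 * (s - 1) + 2) = u m" using per[of m] by metis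
    then show "(u (m + 2 * (s - 1) + 1), u (m + 2 * 0)) \<in> I"
      using RC[OF odd, of "s - 1"] by simp
  qed
qed

theorem theorem1p4:
  fixes R C :: "'v set" and I :: "('v \<times> 'v) set" and p :: ereal
  assumes "countable R" and "countable C" and "R \<inter> C = {}"
    and "I \<subseteq> R \<times> C"
    and "0 < p" and "p \<notin> {ereal (2 * real k) | k. k \<ge> 1}"
    and "real_1_unconditional p C I"
  shows "(\<nexists>vs. is_cycle (bipartite_edges I) vs) \<and>
    (\<forall>\<phi>\<in>linf I. \<exists>u\<in>linf_proj_tensor C R.
        (\<forall>(r, c)\<in>I. tensor_coeff c r u = \<phi> (r, c)) \<and>
        proj_tensor_norm C R u = linf_norm I \<phi>)"
proof -
  have acyclic: "\<nexists>vs. is_cycle (bipartite_edges I) vs"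
  proof
    assume "\<exists>vs. is_cycle (bipartite_edges I) vs"
    then obtain vs where "is_cycle (bipartite_edges I) vs" ..
    from bipartite_cycle_alternates[OF assms(4,3) this] not_unconditional_cycle[OF _ _ _ _ _ _ _ assms(5,6)]
    show False using assms(7) by metis
  qed
  then show ?thesis using acyclic_interpolation[OF assms(4,3)] by blast
qed

end
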